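(* Assume that $\lim_{M+N\to\infty}M/N=\gamma\in(0,\infty)$ and $\lim_{M+N\to\infty}L/N=\tau\in(0,\infty)$. Given $q\in[0,1)$, let $u_N=|u_N|e^{i\theta}$ with $\theta\in(-\pi,\pi]$ be such that $$|u_N|^2=1-\frac1N\lfloor qN\rfloor,$$ and set $$z_j=u_N^M\Big(1+\frac{1}{\sqrt{\gamma MN}}\Big(v_j-\frac{\gamma\tau}{4(1-q)(1-q+\tau)}\Big)\Big)^M,\qquad j=1,\ldots,n.$$ Then the $n$-point correlation functions $R^{(n)}_{M,N}$ of the eigenvalues of $\Pi_M=X_M\cdots X_1$ (a product of i.i.d. truncated unitary matrices) satisfy $$\lim_{M+N\to\infty}|z_1\cdots z_n|^2R^{(n)}_{M,N}(z_1,\ldots,z_n)=\begin{cases}\det\big[\mathrm K^{(\mathrm{bulk})}_{\mathrm{crit}}\big(\tfrac{\gamma\tau}{(1-q)(1-q+\tau)};v_i,v_j\big)\big]_{i,j=1}^n,& q\in(0,1),\\[1ex]\det\big[\mathrm K^{(\mathrm{edge})}_{\mathrm{crit}}\big(\tfrac{\gamma\tau}{1+\tau};v_i,v_j\big)\big]_{i,j=1}^n,& q=0,\end{cases}$$ uniformly for $v_1,\ldots,v_n$ in a compact subset of $\mathbb C$.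
   Context: $\lfloor x\rfloor$ is the largest integer less than or equal to $x$. Model: $X_1,\ldots,X_M$ are i.i.d. truncated unitary matrices, each being the upper left $N\times N$ corner of a random unitary $(N+L)\times(N+L)$ matrix chosen with the Haar measure, and $\Pi_M=X_M\cdots X_1$. The eigenvalues of $\Pi_M$ form a determinantal point process in the complex plane, with correlation functions $R^{(n)}_{M,N}(z_1,\ldots,z_n)=\det[K_{M,N}(z_i,z_j)]_{i,j=1}^n$, where $$K_{M,N}(z_1,z_2)=\frac1\pi\sqrt{w(z_1)w(z_2)}\sum_{j=0}^{N-1}\frac{\Gamma^M(L+j+1)}{\Gamma^M(j+1)}(z_1\overline z_2)^j,\qquad w(z)=\int_{-c-i\infty}^{-c+i\infty}\frac{ds}{2\pi i}\,\frac{\Gamma^M(-s)}{\Gamma^M(L-s)}|z|^{2s}$$ for some $c>0$. Critical kernels: for $\beta\in(0,\infty)$ and $z_1,z_2\in\mathbb C$, $$\mathrm K^{(\mathrm{bulk})}_{\mathrm{crit}}(\beta;z_1,z_2)=\frac{1}{\sqrt{2\pi^3\beta}}\,e^{-\frac{1}{2\beta}(|z_1|^2+|\overline z_2|^2+z_1^2+\overline z_2^2)}\sum_{j=-\infty}^{\infty}e^{-\frac12\beta j^2-(z_1+\overline z_2)j},$$ $$\mathrm K^{(\mathrm{edge})}_{\mathrm{crit}}(\beta;z_1,z_2)=\frac{1}{\sqrt{2\pi^3\beta}}\,e^{-\frac{1}{2\beta}(|z_1|^2+|\overline z_2|^2+z_1^2+\overline z_2^2)}\sum_{j=0}^{\infty}e^{-\frac12\beta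 j^2-(z_1+\overline z_2)j}.$$
   Formalization: The condition |u_N|^2 = 1 - ⌊qN⌋/N is replaced by |u_N|^2 = a/(a + L/N) with a = 1 - ⌊qN⌋/N; with the printed formula the limit fails: for q = 0 and Re v > γτ/(4(1+τ)) the points z eventually lie outside the unit disc, where the correlation function is 0. *)

theory Defs
  imports
    "HOL-Probability.Probability"
    "HOL-Complex_Analysis.Complex_Analysis"
    "Jordan_Normal_Form.Char_Poly"
    "Jordan_Normal_Form.Schur_Decomposition"
begin

text \<open>Matrices are those of \<^theory>\<open>Jordan_Normal_Form.Matrix\<close>, because their sizes vary along the
  limit.  Only the fixed number of points of a correlation function is a finite index type.\<close>

definition matrix_borel :: "nat \<Rightarrow> complex Matrix.mat measure" where
  "matrix_borel n = sigma (carrier_mat n n)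
     {{A \<in> carrier_mat n n. A $$ (i, j) \<in> B} | i j B. i < n \<and> j < n \<and> B \<in> sets borel}"

definition unitary_group :: "nat \<Rightarrow> complex Matrix.mat set" where
  "unitary_group n = {U \<in> carrier_mat n n. mat_adjoint U * U = 1\<^sub>m n}"

definition haar_unitary :: "nat \<Rightarrow> complex Matrix.mat measure \<Rightarrow> bool" where
  "haar_unitary n \<mu> \<longleftrightarrow> prob_space \<mu> \<and>
     sets \<mu> = sets (restrict_space (matrix_borel n) (unitary_group n)) \<and>
     (\<forall>V\<in>unitary_group n. \<forall>A\<in>sets \<mu>. emeasure \<mu> ((\<lambda>U. V * U) ` A) = emeasure \<mu> A)"

definition upper_left :: "nat \<Rightarrow> complex Matrix.mat \<Rightarrow> complex Matrix.mat" where
  "upper_left N U = Matrix.mat N N (\<lambda>(i, j). U $$ (i, j))"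

definition iid_truncated_unitaries ::
    "'w measure \<Rightarrow> nat \<Rightarrow> nat \<Rightarrow> nat \<Rightarrow> (nat \<Rightarrow> 'w \<Rightarrow> complex Matrix.mat) \<Rightarrow> bool" where
  "iid_truncated_unitaries P M N L X \<longleftrightarrow> prob_space P \<and>
     prob_space.indep_vars P (\<lambda>_. matrix_borel N) X {1..M} \<and>
     (\<exists>\<mu>. haar_unitary (N + L) \<mu> \<and>
        (\<forall>i\<in>{1..M}. distr P (matrix_borel N) (X i) = distr \<mu> (matrix_borel N) (upper_left N)))"

text \<open>The product \<open>X\<^sub>M \<cdots> X\<^sub>1\<close> of \<open>N \<times> N\<close> matrices.\<close>

primrec matrix_product :: "nat \<Rightarrow> (nat \<Rightarrow> complex Matrix.mat) \<Rightarrow> nat \<Rightarrow> complex Matrix.mat" where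
  "matrix_product N X 0 = 1\<^sub>m N"
| "matrix_product N X (Suc m) = X (Suc m) * matrix_product N X m"

text \<open>Eigenvalues with algebraic multiplicity, in an unspecified order.\<close>

definition eigenvalue_list :: "complex Matrix.mat \<Rightarrow> complex list" where
  "eigenvalue_list A = (SOME as. char_poly A = (\<Prod>a\<leftarrow>as. [:- a, 1:]))"

text \<open>\<open>R\<close> is a correlation function, with respect to Lebesgue measure, of the point process listed by
  \<open>pts\<close>.  The number of points is \<open>CARD('n)\<close>.  The sum runs over tuples of distinct positions in the
  list, so it does not depend on the order of the list.  This determines \<open>R\<close> almost everywhere.\<close>

definition correlation_function ::
    "'w measure \<Rightarrow> ('w \<Rightarrow> complex list) \<Rightarrow> (complex ^ 'n \<Rightarrow> real) \<Rightarrow> bool" where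
  "correlation_function P pts R \<longleftrightarrow>
     R \<in> borel_measurable borel \<and> (\<forall>z. 0 \<le> R z) \<and>
     (\<forall>g :: complex ^ 'n \<Rightarrow> ennreal. g \<in> borel_measurable borel \<longrightarrow>
        (\<integral>\<^sup>+ \<omega>. (\<Sum>\<sigma> | inj \<sigma> \<and> range \<sigma> \<subseteq> {..<length (pts \<omega>)}. g (\<chi> i. pts \<omega> ! \<sigma> i)) \<partial>P)
        = (\<integral>\<^sup>+ z. g z * ennreal (R z) \<partial>lborel))"

text \<open>The integral over the vertical line is the limit over symmetric segments, since the
  integrand decays only like \<open>\<bar>s\<bar>\<^bsup>-LM\<^esup>\<close> and so is not absolutely integrable if \<open>L = M = 1\<close>.\<close>

definition weight :: "real \<Rightarrow> nat \<Rightarrow> nat \<Rightarrow> complex \<Rightarrow> complex" where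
  "weight c M L z =
     Lim at_top (\<lambda>T::real. contour_integral (linepath (Complex (- c) (- T)) (Complex (- c) T))
       (\<lambda>s. Gamma (- s) ^ M / Gamma (of_nat L - s) ^ M * of_real (cmod z) powr (2 * s)))
     / (2 * of_real pi * \<i>)"

definition eigenvalue_kernel ::
    "real \<Rightarrow> nat \<Rightarrow> nat \<Rightarrow> nat \<Rightarrow> complex \<Rightarrow> complex \<Rightarrow> complex" where
  "eigenvalue_kernel c M N L z1 z2 =
     1 / of_real pi * csqrt (weight c M L z1 * weight c M L z2) *
     (\<Sum>j<N. Gamma (of_nat (L + j + 1)) ^ M / Gamma (of_nat (j + 1)) ^ M * (z1 * cnj z2) ^ j)"

definition K_bulk_crit :: "real \<Rightarrow> complex \<Rightarrow> complex \<Rightarrow> complex" where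
  "K_bulk_crit \<beta> z1 z2 =
     of_real (1 / sqrt (2 * pi ^ 3 * \<beta>)) *
     exp (- 1 / (2 * of_real \<beta>) *
       (of_real ((cmod z1)\<^sup>2) + of_real ((cmod (cnj z2))\<^sup>2) + z1\<^sup>2 + (cnj z2)\<^sup>2)) *
     (\<Sum>\<^sub>\<infinity>j\<in>(UNIV :: int set). exp (- 1 / 2 * of_real \<beta> * of_int j ^ 2 - (z1 + cnj z2) * of_int j))"

definition K_edge_crit :: "real \<Rightarrow> complex \<Rightarrow> complex \<Rightarrow> complex" where
  "K_edge_crit \<beta> z1 z2 =
     of_real (1 / sqrt (2 * pi ^ 3 * \<beta>)) *
     exp (- 1 / (2 * of_real \<beta>) *
       (of_real ((cmod z1)\<^sup>2) + of_real ((cmod (cnj z2))\<^sup>2) + z1\<^sup>2 + (cnj z2)\<^sup>2)) *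
     (\<Sum>j::nat. exp (- 1 / 2 * of_real \<beta> * of_nat j ^ 2 - (z1 + cnj z2) * of_nat j))"

text \<open>The squared modulus of the base point \<open>u\<^sub>N\<close>.  With \<open>m = N - \<lfloor>q N\<rfloor>\<close> it equals \<open>m / (m + L)\<close>.
  The formula \<open>1 - \<lfloor>q N\<rfloor> / N\<close>, printed in the source, is the one for products of Ginibre matrices.
  For truncated unitary matrices the limit is false with it: if \<open>q = 0\<close> and \<open>Re v\<close> is large then
  \<open>z\<close> is outside the unit disc, where there are no eigenvalues, but the edge kernel is positive on
  the diagonal.\<close>

definition base_modulus_sq :: "real \<Rightarrow> nat \<Rightarrow> nat \<Rightarrow> real" where
  "base_modulus_sq q N L =
     (let a = 1 - 1 / real N * of_int \<lfloor>q * real N\<rfloor> in a / (a + real L / real N))"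

definition scaled_point ::
    "real \<Rightarrow> real \<Rightarrow> real \<Rightarrow> nat \<Rightarrow> nat \<Rightarrow> complex \<Rightarrow> complex \<Rightarrow> complex" where
  "scaled_point \<gamma> \<tau> q M N u v =
     u ^ M * (1 + of_real (1 / sqrt (\<gamma> * real M * real N)) *
       (v - of_real (\<gamma> * \<tau> / (4 * (1 - q) * (1 - q + \<tau>))))) ^ M"

end

theory Submission
  imports Defs
begin

text \<open>Put \<open>m = N - \<lfloor>q N\<rfloor>\<close> and \<open>\<beta> = \<gamma> \<tau> / ((1 - q) (1 - q + \<tau>))\<close>.  At the given base point the
  summands of the kernel have modulus maximal near the index \<open>m - 1\<close>, and relative to that term the
  one at distance \<open>j\<close> tends to \<open>exp (- \<beta> j\<^sup>2 / 2 + j (v + cnj w))\<close>.  The quotients of consecutive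
  terms are monotone, which gives a geometric majorant, so Tannery's theorem applies; above the
  peak there are \<open>\<lfloor>q N\<rfloor>\<close> terms, hence a two-sided sum in the bulk and a one-sided sum at the edge.

  For the weight, the integrand is rational up to an exponential factor and the line of integration
  can be moved to real part \<open>- m\<close>.  There it is, after normalisation, the characteristic function of a
  sum of independent exponential variables, whose variance tends to \<open>\<beta>\<close>; dominated convergence
  gives the Gaussian factor.  The remaining unimodular factors have the form \<open>a\<^sub>i * cnj a\<^sub>j\<close> and cancel
  in the determinant.  Uniformity follows from convergence along arbitrary convergent sequences of
  arguments.\<close>

text \<open>The index \<open>m - 1\<close> and the line of real part \<open>- m\<close> belong
  together: the peak coefficient \<open>(\<Prod>l<L. real (m + l)) ^ M\<close> is also the constant
  that normalises the weight on that line. The two cancel exactly, so no Stirling formula enters and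
  only quotients of neighbouring terms have to be estimated. The powers of the moduli match as well:
  the factor in front of the correlation function supplies the one power of \<open>|z|\<close> by
  which \<open>m\<close> exceeds \<open>m - 1\<close>.

  The shift \<open>\<beta> / 4\<close> in the scaled points does two things. The quotient of the
  terms \<open>m\<close> and \<open>m - 1\<close> is \<open>1\<close>, so without the shift the
  Gaussian profile of the terms would be centred halfway between them; the shift moves the centre to
  \<open>m - 1\<close>. It also compensates the constant \<open>\<beta> / 2\<close> left over when
  the diverging mean of the exponential variables is balanced by the modulus of
  \<open>u ^ M\<close>.

  The entries of the kernel need not have a limit, since the phase of \<open>u ^ M\<close> need not
  converge. Convergence is therefore proved for entries stripped of these phases, and only
  determinants are compared.\<close>

subsection \<open>Continuous convergence, determinants and dominated sums\<close>

lemma uniform_limit_compact_sequentially: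
  fixes f :: "nat \<Rightarrow> 'a::metric_space \<Rightarrow> 'b::metric_space"
  assumes K: "compact K"
    and lim: "\<And>v a. (\<And>k. v k \<in> K) \<Longrightarrow> a \<in> K \<Longrightarrow> v \<longlonglongrightarrow> a \<Longrightarrow> (\<lambda>k. f k (v k)) \<longlonglongrightarrow> g a"
  shows "uniform_limit K f g sequentially"
proof (rule ccontr)
  assume "\<not> uniform_limit K f g sequentially"
  then obtain e where "e > 0"
    and e: "\<not> (\<forall>\<^sub>F n in sequentially. \<forall>x\<in>K. dist (f n x) (g x) < e)"
    unfolding uniform_limit_iff by blast
  define A where "A = {n. \<exists>x\<in>K. e \<le> dist (f n x) (g x)}"
  have "infinite A"
    using e unfolding infinite_nat_iff_unbounded_le A_def eventually_sequentially
    by (auto simp: not_less)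
  then have r: "strict_mono (enumerate A)" "\<And>k. enumerate A k \<in> A"
    using strict_mono_enumerate enumerate_in_set by auto
  then have "\<forall>k. \<exists>x\<in>K. e \<le> dist (f (enumerate A k) x) (g x)"
    by (auto simp: A_def)
  then obtain x where x: "\<And>k. x k \<in> K" "\<And>k. e \<le> dist (f (enumerate A k) (x k)) (g (x k))"
    by metis
  obtain a s where a: "a \<in> K" "strict_mono s" "(x \<circ> s) \<longlonglongrightarrow> a"
    using K x(1) unfolding compact_def by meson
  have sub: "(\<lambda>k. f (\<rho> k) ((x \<circ> s) k)) \<longlonglongrightarrow> g a" if \<rho>: "strict_mono \<rho>" for \<rho> :: "nat \<Rightarrow> nat"
  proof -
    \<comment> \<open>The hypothesis speaks of full sequences of arguments, so the values prescribed
      along \<open>\<rho>\<close> are padded with the limit \<open>a\<close> elsewhere.\<close>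
    define w where "w = (\<lambda>n. if n \<in> range \<rho> then (x \<circ> s) (inv_into UNIV \<rho> n) else a)"
    have inj: "inj \<rho>"
      using \<rho> by (rule strict_mono_imp_inj_on)
    have "w \<longlonglongrightarrow> a"
    proof (rule metric_LIMSEQ_I)
      fix \<epsilon> :: real assume "\<epsilon> > 0"
      then obtain k0 where k0: "\<And>k. k \<ge> k0 \<Longrightarrow> dist ((x \<circ> s) k) a < \<epsilon>"
        using metric_LIMSEQ_D[OF a(3)] by blast
      have "dist (w n) a < \<epsilon>" if "n \<ge> \<rho> k0" for n
      proof (cases "n \<in> range \<rho>")
        case True
        then obtain k where k: "n = \<rho> k" by blast
        then have "k \<ge> k0" using that \<rho> by (simp add: strict_mono_less_eq)
        then show ?thesis using k0 k inj by (simp add: w_def)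
      qed (use \<open>\<epsilon> > 0\<close> in \<open>simp add: w_def\<close>)
      then show "\<exists>no. \<forall>n\<ge>no. dist (w n) a < \<epsilon>" by blast
    qed
    moreover have "w k \<in> K" for k
      using x(1) a(1) by (simp add: w_def)
    ultimately have "(\<lambda>k. f k (w k)) \<longlonglongrightarrow> g a"
      using lim a(1) by blast
    from LIMSEQ_subseq_LIMSEQ[OF this \<rho>] show ?thesis
      using inj by (simp add: o_def w_def)
  qed
  have "\<exists>n0. \<forall>n\<ge>n0. dist (f n y) (g y) < e / 2" if "y \<in> K" for y
    using metric_LIMSEQ_D[OF lim[of "\<lambda>_. y" y]] that \<open>e > 0\<close> by (metis half_gt_zero tendsto_const)
  then obtain n0 where n0: "\<And>k n. n \<ge> n0 k \<Longrightarrow> dist (f n ((x \<circ> s) k)) (g ((x \<circ> s) k)) < e / 2"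
    using x(1) by (metis comp_apply)
  \<comment> \<open>At the \<open>k\<close>-th point, \<open>f\<close> is within
    \<open>e / 2\<close> of \<open>g\<close> from index \<open>n0 k\<close> on; partial sums of
    \<open>n0\<close> give a strictly increasing choice of indices beyond these.\<close>
  define \<rho> where "\<rho> k = k + (\<Sum>i\<le>k. n0 i)" for k
  have "strict_mono \<rho>"
    by (auto simp: strict_mono_Suc_iff \<rho>_def)
  moreover have "\<rho> k \<ge> n0 k" for k
    using member_le_sum[of k "{..k}" n0] by (simp add: \<rho>_def)
  ultimately have 1: "(\<lambda>k. f (\<rho> k) ((x \<circ> s) k)) \<longlonglongrightarrow> g a"
    and 2: "\<And>k. dist (f (\<rho> k) ((x \<circ> s) k)) (g ((x \<circ> s) k)) < e / 2"
    using sub n0 by blast+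
  have 3: "(\<lambda>k. f ((enumerate A \<circ> s) k) ((x \<circ> s) k)) \<longlonglongrightarrow> g a"
    using sub strict_mono_o[OF r(1) a(2)] by blast
  have "(\<lambda>k. dist (f (\<rho> k) ((x \<circ> s) k)) (f ((enumerate A \<circ> s) k) ((x \<circ> s) k))) \<longlonglongrightarrow> dist (g a) (g a)"
    by (intro tendsto_dist 1 3)
  then have "\<forall>\<^sub>F k in sequentially. dist (f (\<rho> k) ((x \<circ> s) k)) (f ((enumerate A \<circ> s) k) ((x \<circ> s) k)) < e / 2"
    by (rule order_tendstoD) (use \<open>e > 0\<close> in simp)
  then obtain k where k: "dist (f (\<rho> k) ((x \<circ> s) k)) (f ((enumerate A \<circ> s) k) ((x \<circ> s) k)) < e / 2"
    by (auto simp: eventually_sequentially)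
  have "e \<le> dist (f ((enumerate A \<circ> s) k) ((x \<circ> s) k)) (g ((x \<circ> s) k))"
    using x(2) by simp
  also have "\<dots> < e"
    using k 2[of k] by (rule dist_triangle_half_r)
  finally show False by simp
qed

text \<open>\<open>csqrt\<close> is not multiplicative, but a non-negative real factor keeps the
  argument of a complex number and hence the branch.\<close>

lemma csqrt_of_real_power2_mult:
  assumes "r \<ge> 0"
  shows "csqrt (of_real (r\<^sup>2) * w) = of_real r * csqrt w"
proof (cases "r = 0")
  case False
  then have r: "r > 0" using assms by simp
  show ?thesis
    by (rule csqrt_unique) (use csqrt_principal[of w] r in \<open>auto simp: power_mult_distrib zero_less_mult_iff\<close>)
qed simp

lemma det_diagonal_scale:
  fixes E :: "'n::finite \<Rightarrow> 'n \<Rightarrow> 'a::comm_ring_1"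
  shows "Determinants.det (\<chi> i j. a i * b j * E i j) =
    (\<Prod>i\<in>UNIV. a i) * (\<Prod>i\<in>UNIV. b i) * Determinants.det (\<chi> i j. E i j)"
proof -
  have row: "Determinants.det (\<chi> i j. c i * F i j) = (\<Prod>i\<in>UNIV. c i) * Determinants.det (\<chi> i j. F i j)"
    for c :: "'n \<Rightarrow> 'a" and F :: "'n \<Rightarrow> 'n \<Rightarrow> 'a"
    using Determinants.det_rows_mul[of c "\<lambda>i. \<chi> j. F i j"] by (simp add: vector_scalar_mult_def)
  have "Determinants.det (\<chi> i j. a i * b j * E i j)
      = (\<Prod>i\<in>UNIV. a i) * Determinants.det (\<chi> i j. b j * E i j)"
    using row[of a "\<lambda>i j. b j * E i j"] by (simp add: mult.assoc)
  also have "Determinants.det (\<chi> i j. b j * E i j) = Determinants.det (\<chi> j i. b j * E i j)"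
    by (subst Determinants.det_transpose[symmetric]) (simp add: Finite_Cartesian_Product.transpose_def)
  also have "\<dots> = (\<Prod>i\<in>UNIV. b i) * Determinants.det (\<chi> j i. E i j)"
    by (rule row)
  also have "Determinants.det (\<chi> j i. E i j) = Determinants.det (\<chi> i j. E i j)"
    by (subst Determinants.det_transpose[symmetric]) (simp add: Finite_Cartesian_Product.transpose_def)
  finally show ?thesis by (simp add: mult.assoc)
qed

lemma tendsto_det:
  fixes A :: "'b \<Rightarrow> 'n::finite \<Rightarrow> 'n \<Rightarrow> 'a::real_normed_field"
  assumes "\<And>i j. ((\<lambda>k. A k i j) \<longlongrightarrow> B i j) F"
  shows "((\<lambda>k. Determinants.det (\<chi> i j. A k i j)) \<longlongrightarrow> Determinants.det (\<chi> i j. B i j)) F"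
  unfolding Determinants.det_def by (auto intro!: tendsto_intros assms)

text \<open>\<open>Ln (1 + d)\<close> differs from \<open>d\<close> by \<open>O(|d|^2)\<close>, and
  \<open>M\<close> times this error is at most \<open>2 |M d| |d|\<close>, which vanishes because
  \<open>M d\<close> is bounded and \<open>d\<close> tends to \<open>0\<close>.\<close>

lemma tendsto_one_plus_power_exp:
  fixes d :: "nat \<Rightarrow> complex"
  assumes M: "filterlim M at_top sequentially"
    and d: "(\<lambda>n. of_nat (M n) * d n) \<longlonglongrightarrow> x"
  shows "(\<lambda>n. (1 + d n) ^ M n) \<longlonglongrightarrow> exp x"
proof -
  have M': "filterlim (\<lambda>n. real (M n)) at_top sequentially"
    using M filterlim_compose filterlim_real_sequentially by blast
  have Mpos: "\<forall>\<^sub>F n in sequentially. M n > 0"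
    using filterlim_at_top[THEN iffD1, OF M, rule_format, of 1] by (auto elim: eventually_mono)
  have "(\<lambda>n. (of_nat (M n) * d n) * of_real (inverse (real (M n)))) \<longlonglongrightarrow> x * of_real 0"
    by (intro tendsto_mult d tendsto_of_real tendsto_inverse_0_at_top M')
  then have "(\<lambda>n. (of_nat (M n) * d n) * of_real (inverse (real (M n)))) \<longlonglongrightarrow> 0"
    by simp
  moreover have "\<forall>\<^sub>F n in sequentially. (of_nat (M n) * d n) * of_real (inverse (real (M n))) = d n"
    using Mpos by eventually_elim (simp add: field_simps)
  ultimately have d0: "d \<longlonglongrightarrow> 0"
    by (rule Lim_transform_eventually)
  have small: "\<forall>\<^sub>F n in sequentially. norm (d n) < 1 / 2"
    using tendsto_norm_zero[OF d0] by (rule order_tendstoD) simp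
  have "(\<lambda>n. 2 * norm (of_nat (M n) * d n) * norm (d n)) \<longlonglongrightarrow> 2 * norm x * norm (0::complex)"
    by (intro tendsto_intros d d0)
  then have lim0: "(\<lambda>n. 2 * norm (of_nat (M n) * d n) * norm (d n)) \<longlonglongrightarrow> 0"
    by simp
  have "\<forall>\<^sub>F n in sequentially. norm (of_nat (M n) * (Ln (1 + d n) - d n)) \<le> 2 * norm (of_nat (M n) * d n) * norm (d n)"
    using small
  proof eventually_elim
    case (elim n)
    have "norm (Ln (1 + d n) - d n) \<le> (norm (d n))\<^sup>2 / (1 - norm (d n))"
      by (rule Ln_approx_linear) (use elim in simp)
    also have "\<dots> \<le> (norm (d n))\<^sup>2 / (1/2)"
      by (rule divide_left_mono) (use elim in auto)
    finally have "real (M n) * norm (Ln (1 + d n) - d n) \<le> real (M n) * ((norm (d n))\<^sup>2 / (1/2))"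
      by (rule mult_left_mono) simp
    then show ?case
      by (simp add: norm_mult power2_eq_square mult_ac)
  qed
  then have "(\<lambda>n. of_nat (M n) * (Ln (1 + d n) - d n)) \<longlonglongrightarrow> 0"
    using lim0 by (rule Lim_null_comparison)
  from tendsto_exp[OF tendsto_add[OF d this]]
  have "(\<lambda>n. exp (of_nat (M n) * Ln (1 + d n))) \<longlonglongrightarrow> exp x"
    by (simp add: algebra_simps)
  then show ?thesis
  proof (rule Lim_transform_eventually)
    show "\<forall>\<^sub>F n in sequentially. exp (of_nat (M n) * Ln (1 + d n)) = (1 + d n) ^ M n"
      using small
    proof eventually_elim
      case (elim n)
      then have "1 + d n \<noteq> 0"
        by (auto simp: add_eq_0_iff)
      then show ?case by (simp add: exp_of_nat_mult exp_Ln)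
    qed
  qed
qed

lemma tendsto_suminf_of_ratio_bound:
  fixes a :: "nat \<Rightarrow> nat \<Rightarrow> complex"
  assumes lim: "\<And>k. (\<lambda>n. a k n) \<longlonglongrightarrow> b k"
    and ratio: "\<forall>\<^sub>F n in sequentially. \<forall>k\<ge>k0. norm (a (Suc k) n) \<le> norm (a k n) / 2"
  shows "summable (\<lambda>k. norm (b k))" "(\<lambda>n. \<Sum>k. a k n) \<longlonglongrightarrow> (\<Sum>k. b k)"
proof -
  define B where "B = norm (b k0) + 1"
  have "\<forall>\<^sub>F n in sequentially. norm (a k0 n) < B"
    using tendsto_norm[OF lim[of k0]] by (rule order_tendstoD) (simp add: B_def)
  with ratio have ev: "\<forall>\<^sub>F n in sequentially. \<forall>k\<ge>k0. norm (a k n) \<le> B * 2 ^ k0 * (1/2) ^ k"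
  proof eventually_elim
    case (elim n)
    show ?case
    proof (intro allI impI)
      fix k assume "k \<ge> k0"
      then show "norm (a k n) \<le> B * 2 ^ k0 * (1/2) ^ k"
      proof (induction k rule: dec_induct)
        case base
        then show ?case using elim by (simp add: power_one_over)
      next
        case (step k)
        then show ?case using elim(1)[rule_format, OF step(1)] by simp
      qed
    qed
  qed
  \<comment> \<open>Tannery's theorem wants the majorant only eventually in both variables, so the
    indices below \<open>k0\<close> need no bound.\<close>
  have "\<forall>\<^sub>F (k, n) in at_top \<times>\<^sub>F sequentially. norm (a k n) \<le> B * 2 ^ k0 * (1/2) ^ k"
    unfolding eventually_prod_filter
    by (rule exI[of _ "\<lambda>k. k \<ge> k0"], rule exI[of _ "\<lambda>n. \<forall>k\<ge>k0. norm (a k n) \<le> B * 2 ^ k0 * (1/2) ^ k"])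
       (use ev in \<open>auto simp: eventually_ge_at_top\<close>)
  then have "summable (\<lambda>k. norm (b k)) \<and> (\<lambda>n. \<Sum>k. a k n) \<longlonglongrightarrow> (\<Sum>k. b k)"
    using tannerys_theorem[of a b sequentially "\<lambda>k. B * 2 ^ k0 * (1/2) ^ k"] lim
    by (auto intro!: summable_mult summable_geometric)
  then show "summable (\<lambda>k. norm (b k))" "(\<lambda>n. \<Sum>k. a k n) \<longlonglongrightarrow> (\<Sum>k. b k)"
    by auto
qed

text \<open>The exponents \<open>- \<beta> (l + \<delta>)\<close> of the limiting quotients add up
  to \<open>- \<beta> k^2 / 2 + k (\<beta> / 2 - \<beta> \<delta>)\<close>. Because the quotients
  decrease in \<open>l\<close>, a single \<open>k0\<close> at which the limiting ratio is below
  \<open>1 / 2\<close> controls all later ones at once, which gives the geometric majorant.\<close>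

lemma tendsto_sum_quadratic_exponential:
  fixes \<rho> :: "nat \<Rightarrow> nat \<Rightarrow> real" and \<zeta> :: "nat \<Rightarrow> complex"
  assumes \<beta>: "\<beta> > 0"
    and K: "filterlim K at_top sequentially"
    and nonneg: "\<And>l n. l < K n \<Longrightarrow> 0 \<le> \<rho> l n"
    and decr: "\<And>l l' n. l \<le> l' \<Longrightarrow> l' < K n \<Longrightarrow> \<rho> l' n \<le> \<rho> l n"
    and \<rho>: "\<And>l. (\<lambda>n. \<rho> l n) \<longlonglongrightarrow> exp (- \<beta> * (real l + \<delta>))"
    and \<zeta>: "\<zeta> \<longlonglongrightarrow> exp \<sigma>"
  shows "summable (\<lambda>k. norm (exp (- of_real (\<beta> / 2) * of_nat k ^ 2 + of_nat k * (\<sigma> + of_real (\<beta> / 2 - \<beta> * \<delta>)))))"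
    "(\<lambda>n. \<Sum>k<K n. (\<Prod>l<k. of_real (\<rho> l n)) * \<zeta> n ^ k) \<longlonglongrightarrow>
      (\<Sum>k. exp (- of_real (\<beta> / 2) * of_nat k ^ 2 + of_nat k * (\<sigma> + of_real (\<beta> / 2 - \<beta> * \<delta>))))"
proof -
  define a where "a k n = (if k < K n then (\<Prod>l<k. of_real (\<rho> l n)) * \<zeta> n ^ k else 0)" for k n
  define b where "b k = exp (- of_real (\<beta> / 2) * of_nat k ^ 2 + of_nat k * (\<sigma> + of_real (\<beta> / 2 - \<beta> * \<delta>)))" for k
  have b: "b k = (\<Prod>l<k. of_real (exp (- \<beta> * (real l + \<delta>)))) * exp \<sigma> ^ k" for k
  proof (induction k)
    case (Suc k)
    have "b (Suc k) = b k * (of_real (exp (- \<beta> * (real k + \<delta>))) * exp \<sigma>)"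
      unfolding b_def exp_of_real[symmetric] mult_exp_exp
      by (rule arg_cong[of _ _ exp]) (simp add: algebra_simps power2_eq_square add_divide_distrib)
    then show ?case by (simp add: Suc mult_ac)
  qed (simp add: b_def)
  have lim: "(\<lambda>n. a k n) \<longlonglongrightarrow> b k" for k
  proof (rule Lim_transform_eventually)
    show "(\<lambda>n. (\<Prod>l<k. of_real (\<rho> l n)) * \<zeta> n ^ k) \<longlonglongrightarrow> b k"
      unfolding b by (intro tendsto_intros \<rho> \<zeta>)
    have "\<forall>\<^sub>F n in sequentially. k < K n"
      using filterlim_at_top[THEN iffD1, OF K, rule_format, of "Suc k"] by (simp add: Suc_le_eq)
    then show "\<forall>\<^sub>F n in sequentially. (\<Prod>l<k. of_real (\<rho> l n)) * \<zeta> n ^ k = a k n"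
      by eventually_elim (simp add: a_def)
  qed
  have "(\<lambda>k. exp (- \<beta> * (real k + \<delta>)) * norm (exp \<sigma>)) \<longlonglongrightarrow> 0"
    using \<beta> by real_asymp
  then have "\<forall>\<^sub>F k in sequentially. exp (- \<beta> * (real k + \<delta>)) * norm (exp \<sigma>) < 1/2"
    by (rule order_tendstoD) simp
  then obtain k0 where k0: "exp (- \<beta> * (real k0 + \<delta>)) * norm (exp \<sigma>) < 1/2"
    by (auto simp: eventually_sequentially)
  have "(\<lambda>n. \<rho> k0 n * norm (\<zeta> n)) \<longlonglongrightarrow> exp (- \<beta> * (real k0 + \<delta>)) * norm (exp \<sigma>)"
    by (intro tendsto_intros \<rho> \<zeta>)
  then have "\<forall>\<^sub>F n in sequentially. \<rho> k0 n * norm (\<zeta> n) < 1/2"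
    using k0 by (rule order_tendstoD)
  then have ratio: "\<forall>\<^sub>F n in sequentially. \<forall>k\<ge>k0. norm (a (Suc k) n) \<le> norm (a k n) / 2"
  proof eventually_elim
    case (elim n)
    show ?case
    proof (intro allI impI)
      fix k assume "k \<ge> k0"
      show "norm (a (Suc k) n) \<le> norm (a k n) / 2"
      proof (cases "Suc k < K n")
        case True
        then have "norm (a (Suc k) n) = norm (a k n) * (\<rho> k n * norm (\<zeta> n))"
          using nonneg[of k n] by (simp add: a_def norm_mult)
        also have "\<rho> k n * norm (\<zeta> n) \<le> \<rho> k0 n * norm (\<zeta> n)"
          using True \<open>k \<ge> k0\<close> by (intro mult_right_mono decr) auto
        also have "\<dots> \<le> 1 / 2" using elim by simp
        finally show ?thesis by (simp add: mult_left_mono)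
      qed (simp add: a_def)
    qed
  qed
  have "(\<lambda>n. \<Sum>k. a k n) = (\<lambda>n. \<Sum>k<K n. (\<Prod>l<k. of_real (\<rho> l n)) * \<zeta> n ^ k)"
    by (rule ext, subst suminf_finite[of "{..<K _}"]) (auto simp: a_def)
  then show "summable (\<lambda>k. norm (exp (- of_real (\<beta> / 2) * of_nat k ^ 2 + of_nat k * (\<sigma> + of_real (\<beta> / 2 - \<beta> * \<delta>)))))"
    "(\<lambda>n. \<Sum>k<K n. (\<Prod>l<k. of_real (\<rho> l n)) * \<zeta> n ^ k) \<longlonglongrightarrow>
      (\<Sum>k. exp (- of_real (\<beta> / 2) * of_nat k ^ 2 + of_nat k * (\<sigma> + of_real (\<beta> / 2 - \<beta> * \<delta>))))"
    using tendsto_suminf_of_ratio_bound[of a b k0, OF lim ratio] by (simp_all add: b_def)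
qed

subsection \<open>The weight as a Fourier integral\<close>

lemma integrable_inverse_one_plus_square:
  assumes "\<kappa> > 0"
  shows "integrable lborel (\<lambda>t::real. 1 / (1 + \<kappa> * t\<^sup>2))"
proof -
  have "integrable lborel (\<lambda>t::real. inverse (1 + t\<^sup>2))"
    using integrable_inverse_1_plus_square by (simp add: set_integrable_def)
  then have "integrable lborel (\<lambda>t::real. inverse (1 + (0 + sqrt \<kappa> * t)\<^sup>2))"
    by (rule lborel_integrable_real_affine) (use assms in simp)
  then show ?thesis
    using assms by (simp add: power_mult_distrib inverse_eq_divide)
qed

text \<open>The characteristic function of a sum of \<open>M * L\<close> independent exponential variables, \<open>M\<close> of them
  for each of the rates \<open>m, \<dots>, m + L - 1\<close>.\<close>

definition exponential_char :: "nat \<Rightarrow> nat \<Rightarrow> nat \<Rightarrow> real \<Rightarrow> complex" where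
  "exponential_char M L m t = (\<Prod>l<L. 1 / (1 - \<i> * of_real (t / real (m + l)))) ^ M"

lemma norm_one_minus_ii: "norm (1 - \<i> * of_real x) = sqrt (1 + x\<^sup>2)"
  by (simp add: cmod_def)

lemma continuous_exponential_char:
  assumes "m > 0"
  shows "continuous_on UNIV (exponential_char M L m)"
proof -
  have "1 - \<i> * of_real x \<noteq> 0" for x :: real
    by (simp add: complex_eq_iff)
  then show ?thesis
    unfolding exponential_char_def using assms by (intro continuous_intros) auto
qed

text \<open>Each of the \<open>M * L\<close> denominators has modulus at least
  \<open>sqrt (1 + y)\<close>. Pairing them gives \<open>(1 + y) ^ (M * L div 2)\<close>, from which
  Bernoulli's inequality extracts a quadratic term. The majorant is uniform along the limit once its
  coefficient stays away from \<open>0\<close>.\<close>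

lemma norm_exponential_char_le:
  assumes "m > 0"
  shows "norm (exponential_char M L m t) \<le> 1 / (1 + real (M * L div 2) / (real (m + L))\<^sup>2 * t\<^sup>2)"
proof -
  define y where "y = (t / real (m + L))\<^sup>2"
  have y: "y \<ge> 0" by (simp add: y_def)
  have "1 + real (M * L div 2) * y \<le> (1 + y) ^ (M * L div 2)"
    using Bernoulli_inequality[of y "M * L div 2"] y by simp
  also have "\<dots> = sqrt (1 + y) ^ (2 * (M * L div 2))"
    using y by (simp add: power_mult)
  also have "\<dots> \<le> sqrt (1 + y) ^ (L * M)"
    using times_div_less_eq_dividend[of 2 "M * L"] y by (intro power_increasing) (auto simp: mult.commute)
  also have "\<dots> = (\<Prod>l<L. sqrt (1 + y)) ^ M"
    by (simp add: power_mult)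
  also have "\<dots> \<le> (\<Prod>l<L. norm (1 - \<i> * of_real (t / real (m + l)))) ^ M"
  proof (intro power_mono prod_mono conjI prod_nonneg ballI)
    fix l assume "l \<in> {..<L}"
    then have "\<bar>t\<bar> / real (m + L) \<le> \<bar>t\<bar> / real (m + l)"
      using assms by (intro divide_left_mono) auto
    then have "(\<bar>t\<bar> / real (m + L))\<^sup>2 \<le> (\<bar>t\<bar> / real (m + l))\<^sup>2"
      by (rule power_mono) simp
    then show "sqrt (1 + y) \<le> norm (1 - \<i> * of_real (t / real (m + l)))"
      unfolding norm_one_minus_ii by (simp add: y_def power_divide)
  qed (use y in auto)
  finally have "1 + real (M * L div 2) * y \<le> (\<Prod>l<L. norm (1 - \<i> * of_real (t / real (m + l)))) ^ M" .
  moreover have "0 < 1 + real (M * L div 2) * y"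
    using y by (simp add: add_pos_nonneg)
  ultimately have "1 / (\<Prod>l<L. norm (1 - \<i> * of_real (t / real (m + l)))) ^ M \<le> 1 / (1 + real (M * L div 2) * y)"
    by (intro divide_left_mono mult_pos_pos) auto
  then show ?thesis
    by (simp add: exponential_char_def norm_power norm_divide prod_norm[symmetric] prod_dividef y_def power_divide power_one_over)
qed

lemma integrable_exponential_char:
  assumes "m > 0" "M * L \<ge> 2"
  shows "integrable lborel (\<lambda>t. exponential_char M L m t * exp (2 * \<i> * of_real (t * y)))"
proof (rule Bochner_Integration.integrable_bound)
  have "0 < M * L div 2" using assms(2) by linarith
  then show "integrable lborel (\<lambda>t. 1 / (1 + real (M * L div 2) / (real (m + L))\<^sup>2 * t\<^sup>2))"
    using assms by (intro integrable_inverse_one_plus_square) simp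
  show "(\<lambda>t. exponential_char M L m t * exp (2 * \<i> * of_real (t * y))) \<in> borel_measurable lborel"
  proof -
    have "continuous_on UNIV (\<lambda>t. exponential_char M L m t * exp (2 * \<i> * of_real (t * y)))"
      by (intro continuous_intros continuous_exponential_char assms)
    then show ?thesis by (simp add: borel_measurable_continuous_onI)
  qed
  show "AE t in lborel. norm (exponential_char M L m t * exp (2 * \<i> * of_real (t * y)))
      \<le> norm (1 / (1 + real (M * L div 2) / (real (m + L))\<^sup>2 * t\<^sup>2))"
    using norm_exponential_char_le[OF assms(1), of M L] by (auto simp: norm_mult intro!: AE_I2 order.trans[OF _ abs_ge_self])
qed

text \<open>In this rational form the only poles are \<open>0, ..., L - 1\<close>, outside the left
  half-plane; hence the line of integration may be moved freely inside it.\<close>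

lemma Gamma_ratio_left_half_plane:
  assumes "Re s < 0"
  shows "Gamma (- s) / Gamma (of_nat L - s) = (\<Prod>l<L. 1 / (of_nat l - s))"
proof -
  have "- s \<notin> \<int>\<^sub>\<le>\<^sub>0"
    using assms by (auto elim!: nonpos_Ints_cases simp: minus_equation_iff[of s])
  then have "Gamma (of_nat L - s) / Gamma (- s) = (\<Prod>l<L. of_nat l - s)"
    using pochhammer_Gamma[of "- s" L] by (simp add: pochhammer_prod lessThan_atLeast0 add.commute)
  from this[symmetric] show ?thesis
    by (simp add: prod_dividef)
qed

text \<open>A primitive on the convex half-plane turns the difference of the vertical integrals into
  a difference of two horizontal ones, of fixed length and with integrand at most
  \<open>E / T\<close>. First-order decay is enough, although the vertical integrals need not
  converge absolutely then.\<close>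

lemma vertical_segment_shift:
  fixes F :: "complex \<Rightarrow> complex"
  assumes F: "F holomorphic_on {s. Re s < 0}"
    and a: "a < 0" and b: "b < 0"
    and bound: "\<And>s. Re s \<in> closed_segment a b \<Longrightarrow> \<bar>Im s\<bar> \<ge> 1 \<Longrightarrow> norm (F s) \<le> E / \<bar>Im s\<bar>"
  shows "((\<lambda>T. contour_integral (linepath (Complex a (- T)) (Complex a T)) F
    - contour_integral (linepath (Complex b (- T)) (Complex b T)) F) \<longlongrightarrow> 0) at_top"
proof -
  define D where "D = {s. Re s < 0}"
  have D: "convex D" "open D"
    unfolding D_def by (auto simp: convex_halfspace_Re_lt open_halfspace_Re_lt)
  obtain g where g: "\<And>x. x \<in> D \<Longrightarrow> (g has_field_derivative F x) (at x within D)"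
    using holomorphic_convex_primitive'[OF D] F by (metis D_def)
  have seg: "closed_segment x y \<subseteq> D" if "x \<in> D" "y \<in> D" for x y
    using D(1) that by (simp add: closed_segment_subset)
  have int: "(F has_contour_integral (g y - g x)) (linepath x y)" if "x \<in> D" "y \<in> D" for x y
    using contour_integral_primitive[OF g valid_path_linepath, of x y] seg[OF that] by simp
  have hor: "norm (g (Complex b y) - g (Complex a y)) \<le> E * \<bar>b - a\<bar> / \<bar>y\<bar>" if y: "\<bar>y\<bar> \<ge> 1" for y
  proof -
    have E: "0 \<le> E / \<bar>y\<bar>"
      using order.trans[OF norm_ge_zero bound[of "Complex a y"]] y by simp
    have "norm (g (Complex b y) - g (Complex a y)) \<le> E / \<bar>y\<bar> * norm (Complex b y - Complex a y)"
    proof (rule has_contour_integral_bound_linepath[OF int E])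
      fix x assume "x \<in> closed_segment (Complex a y) (Complex b y)"
      then obtain u where u: "x = (1 - u) *\<^sub>R Complex a y + u *\<^sub>R Complex b y" "0 \<le> u" "u \<le> 1"
        by (auto simp: in_segment)
      have "Re x = (1 - u) * a + u * b" and Im: "Im x = y"
        unfolding u(1) by (simp_all add: algebra_simps)
      with u(2,3) have "Re x \<in> closed_segment a b"
        by (auto simp: in_segment)
      then show "norm (F x) \<le> E / \<bar>y\<bar>" using bound[of x] y Im by simp
    qed (use a b in \<open>auto simp: D_def\<close>)
    also have "norm (Complex b y - Complex a y) = \<bar>b - a\<bar>"
      by (simp add: cmod_def)
    finally show ?thesis by simp
  qed
  have "((\<lambda>T. 2 * (E * \<bar>b - a\<bar>) / T) \<longlongrightarrow> 0) at_top"
    by real_asymp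
  then show ?thesis
  proof (rule Lim_null_comparison[rotated])
    show "\<forall>\<^sub>F T in at_top. norm (contour_integral (linepath (Complex a (- T)) (Complex a T)) F
      - contour_integral (linepath (Complex b (- T)) (Complex b T)) F) \<le> 2 * (E * \<bar>b - a\<bar>) / T"
      using eventually_ge_at_top[of 1]
    proof eventually_elim
      case (elim T)
      have eq: "contour_integral (linepath (Complex a (- T)) (Complex a T)) F
          - contour_integral (linepath (Complex b (- T)) (Complex b T)) F
          = (g (Complex b (- T)) - g (Complex a (- T))) - (g (Complex b T) - g (Complex a T))"
        using a b by (subst (1 2) contour_integral_unique[OF int]) (auto simp: D_def)
      show ?case
        unfolding eq using elim hor[of T] hor[of "- T"]
        by (intro order.trans[OF norm_triangle_ineq4]) simp
    qed
  qed
qed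

text \<open>On the line of real part \<open>- m\<close> the factor \<open>1 / (l - s)\<close> is
  \<open>1 / (m + l)\<close> times \<open>1 / (1 - \<i> t / (m + l))\<close>, and
  \<open>|z|^(2 s)\<close> is \<open>|z|^(- 2 m)\<close> times a phase; the constants form the
  normalisation on the left. Two factors make the integral over this line absolutely convergent, so
  the limit over symmetric segments is found there and carried over to real part
  \<open>- c\<close>.\<close>

lemma weight_eq_integral:
  assumes c: "c > 0" and m: "m > 0" and two_le: "M * L \<ge> 2" and z: "z \<noteq> 0"
  shows "weight c M L z * of_real ((\<Prod>l<L. real (m + l)) ^ M * cmod z ^ (2 * m)) =
    (LINT t|lborel. exponential_char M L m t * exp (2 * \<i> * of_real (t * ln (cmod z)))) / of_real (2 * pi)"
proof -
  define F :: "complex \<Rightarrow> complex" where "F s = (\<Prod>l<L. 1 / (of_nat l - s)) ^ M * exp (2 * s * of_real (ln (cmod z)))" for s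
  define C where "C = (\<Prod>l<L. real (m + l)) ^ M * cmod z ^ (2 * m)"
  define G where "G t = exponential_char M L m t * exp (2 * \<i> * of_real (t * ln (cmod z)))" for t
  have "(\<Prod>l<L. real (m + l)) > 0"
    using m by (intro prod_pos) auto
  then have C: "C > 0"
    using z by (simp add: C_def)
  have nz: "of_nat l - s \<noteq> 0" if "Re s < 0" for s and l :: nat
    using that by (auto simp: complex_eq_iff)
  have integrand: "Gamma (- s) ^ M / Gamma (of_nat L - s) ^ M * of_real (cmod z) powr (2 * s) = F s"
    if "Re s < 0" for s
    using z Gamma_ratio_left_half_plane[OF that, of L]
    by (simp add: F_def powr_def Ln_of_real flip: power_divide)
  have holo: "F holomorphic_on {s. Re s < 0}"
    unfolding F_def using nz by (intro holomorphic_intros) auto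
  have F_line: "F (Complex (- real m) t) = G t / of_real C" for t
  proof -
    have "1 / (of_nat l - Complex (- real m) t) = 1 / (1 - \<i> * of_real (t / real (m + l))) / of_real (real (m + l))" for l
    proof -
      have "of_nat l - Complex (- real m) t = (1 - \<i> * of_real (t / real (m + l))) * of_real (real (m + l))"
        using m by (simp add: complex_eq_iff field_simps)
      then show ?thesis by simp
    qed
    moreover have "exp (2 * Complex (- real m) t * of_real (ln (cmod z))) =
      exp (2 * \<i> * of_real (t * ln (cmod z))) / of_real (cmod z ^ (2 * m))"
    proof -
      have "2 * Complex (- real m) t * of_real (ln (cmod z)) =
        2 * \<i> * of_real (t * ln (cmod z)) - of_real (real (2 * m) * ln (cmod z))"
        by (simp add: complex_eq_iff)
      moreover have "exp (real (2 * m) * ln (cmod z)) = cmod z ^ (2 * m)"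
        using z by (subst exp_of_nat_mult) simp
      ultimately show ?thesis
        by (simp only: exp_diff exp_of_real)
    qed
    ultimately show ?thesis
      by (simp add: F_def G_def C_def exponential_char_def prod_dividef power_divide prod.distrib power_mult_distrib)
  qed
  have bound: "norm (F s) \<le> exp (2 * (c + real m) * \<bar>ln (cmod z)\<bar>) / \<bar>Im s\<bar>"
    if s: "Re s \<in> closed_segment (- c) (- real m)" and Im: "\<bar>Im s\<bar> \<ge> 1" for s
  proof -
    have Re: "\<bar>Re s\<bar> \<le> c + real m"
      using s c m by (auto simp: closed_segment_eq_real_ivl split: if_splits)
    \<comment> \<open>Every denominator has modulus at least \<open>|Im s|\<close>, and since
      \<open>|Im s|\<close> is at least \<open>1\<close>, one of them suffices for the
      decay.\<close>
    have "(\<Prod>l<L. norm (of_nat l - s)) ^ M \<ge> (\<Prod>l<L. \<bar>Im s\<bar>) ^ M"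
      using abs_Im_le_cmod[of "of_nat _ - s"] by (intro power_mono prod_mono prod_nonneg) auto
    also have "(\<Prod>l<L. \<bar>Im s\<bar>) ^ M = \<bar>Im s\<bar> ^ (M * L)"
      by (simp add: power_mult mult.commute)
    also have "\<bar>Im s\<bar> ^ (M * L) \<ge> \<bar>Im s\<bar> ^ 1"
      using Im two_le by (intro power_increasing; linarith)
    finally have 1: "\<bar>Im s\<bar> \<le> (\<Prod>l<L. norm (of_nat l - s)) ^ M" by simp
    have "2 * (Re s * ln (cmod z)) \<le> 2 * (\<bar>Re s\<bar> * \<bar>ln (cmod z)\<bar>)"
      by (metis abs_ge_self abs_mult mult_left_mono zero_le_numeral)
    also have "\<dots> \<le> 2 * ((c + real m) * \<bar>ln (cmod z)\<bar>)"
      using Re by (intro mult_left_mono mult_right_mono) auto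
    finally have "2 * Re s * ln (cmod z) \<le> 2 * (c + real m) * \<bar>ln (cmod z)\<bar>"
      by (simp only: mult.assoc)
    then have 2: "exp (2 * Re s * ln (cmod z)) \<le> exp (2 * (c + real m) * \<bar>ln (cmod z)\<bar>)"
      by (simp only: exp_le_cancel_iff)
    have "norm (F s) = exp (2 * Re s * ln (cmod z)) / (\<Prod>l<L. norm (of_nat l - s)) ^ M"
      by (simp add: F_def norm_mult norm_power prod_norm[symmetric] norm_divide prod_dividef power_divide)
    also have "\<dots> \<le> exp (2 * (c + real m) * \<bar>ln (cmod z)\<bar>) / \<bar>Im s\<bar>"
      using 1 2 Im by (intro frac_le) auto
    finally show ?thesis .
  qed
  have G: "integrable lborel G"
    unfolding G_def by (rule integrable_exponential_char[OF m two_le])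
  then have Gm[measurable]: "G \<in> borel_measurable borel" by auto
  have vertical: "((\<lambda>T. contour_integral (linepath (Complex (- real m) (- T)) (Complex (- real m) T)) F)
    \<longlongrightarrow> \<i> * (integral\<^sup>L lborel G / of_real C)) at_top"
  proof (rule Lim_transform_eventually)
    have "((\<lambda>T. LINT t|lborel. indicator {- T..T} t *\<^sub>R G t) \<longlongrightarrow> integral\<^sup>L lborel G) at_top"
    proof (rule integral_dominated_convergence_at_top[where w = "\<lambda>t. norm (G t)"])
      show "AE t in lborel. ((\<lambda>T. indicator {- T..T} t *\<^sub>R G t) \<longlongrightarrow> G t) at_top"
      proof (rule AE_I2)
        fix t :: real
        have "\<forall>\<^sub>F T in at_top. G t = indicator {- T..T} t *\<^sub>R G t"
          using eventually_ge_at_top[of "\<bar>t\<bar>"] by eventually_elim (auto simp: indicator_def)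
        then show "((\<lambda>T. indicator {- T..T} t *\<^sub>R G t) \<longlongrightarrow> G t) at_top"
          by (rule tendsto_eventually[OF eventually_mono]) simp
      qed
    qed (use G in \<open>auto simp: indicator_def\<close>)
    then show "((\<lambda>T. \<i> * ((LINT t|lborel. indicator {- T..T} t *\<^sub>R G t) / of_real C))
      \<longlongrightarrow> \<i> * (integral\<^sup>L lborel G / of_real C)) at_top"
      by (intro tendsto_intros) (use C in auto)
    show "\<forall>\<^sub>F T in at_top. \<i> * ((LINT t|lborel. indicator {- T..T} t *\<^sub>R G t) / of_real C) =
      contour_integral (linepath (Complex (- real m) (- T)) (Complex (- real m) T)) F"
      using eventually_gt_at_top[of 0]
    proof eventually_elim
      case (elim T)
      have "set_integrable lborel {- T..T} G"
        using G unfolding set_integrable_def by (rule integrable_mult_indicator[rotated]) simp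
      then have "integral {- T..T} G = (LINT t|lborel. indicator {- T..T} t *\<^sub>R G t)"
        using set_borel_integral_eq_integral(2) by (metis set_lebesgue_integral_def)
      then show ?case
        using elim by (subst contour_integral_linepath_same_Re[of _ "- real m" _ "- T" T]) (simp_all add: F_line)
    qed
  qed
  have "((\<lambda>T. contour_integral (linepath (Complex (- c) (- T)) (Complex (- c) T)) F
    - contour_integral (linepath (Complex (- real m) (- T)) (Complex (- real m) T)) F) \<longlongrightarrow> 0) at_top"
    by (rule vertical_segment_shift[OF holo _ _ bound]) (use c m in auto)
  from tendsto_add[OF this vertical]
  have "((\<lambda>T. contour_integral (linepath (Complex (- c) (- T)) (Complex (- c) T)) F)
    \<longlongrightarrow> \<i> * (integral\<^sup>L lborel G / of_real C)) at_top"
    by simp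
  moreover have "contour_integral (linepath (Complex (- c) (- T)) (Complex (- c) T)) F =
      contour_integral (linepath (Complex (- c) (- T)) (Complex (- c) T))
        (\<lambda>s. Gamma (- s) ^ M / Gamma (of_nat L - s) ^ M * of_real (cmod z) powr (2 * s))" for T
  proof (rule contour_integral_cong[OF refl])
    fix s assume "s \<in> path_image (linepath (Complex (- c) (- T)) (Complex (- c) T))"
    then obtain u where "s = (1 - u) *\<^sub>R Complex (- c) (- T) + u *\<^sub>R Complex (- c) T"
      by (auto simp: in_segment)
    then have "Re s = - c"
      by (simp only: plus_complex.sel scaleR_complex.sel complex.sel) (simp add: algebra_simps)
    then show "F s = Gamma (- s) ^ M / Gamma (of_nat L - s) ^ M * of_real (cmod z) powr (2 * s)"
      using integrand c by simp
  qed
  ultimately have "weight c M L z = \<i> * (integral\<^sup>L lborel G / of_real C) / (2 * of_real pi * \<i>)"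
    unfolding weight_def by (subst tendsto_Lim) auto
  then show ?thesis
    using C unfolding C_def[symmetric] G_def[symmetric] by simp
qed

subsection \<open>Gaussian limit of the weight\<close>

lemma ln_one_plus_quadratic_bound:
  fixes h :: real
  assumes "h \<ge> 0"
  shows "\<bar>h - ln (1 + h) - h\<^sup>2 / 2\<bar> \<le> h ^ 3"
proof -
  have "ln (1 + 0) - 0 + 0\<^sup>2 / 2 \<le> ln (1 + h) - h + h\<^sup>2 / 2"
  proof (rule DERIV_nonneg_imp_nondecreasing[OF assms], rule exI, rule conjI)
    fix x :: real assume x: "0 \<le> x"
    show "((\<lambda>x. ln (1 + x) - x + x\<^sup>2 / 2) has_real_derivative (1 / (1 + x) - 1 + x)) (at x)"
      using x by (auto intro!: derivative_eq_intros)
    show "0 \<le> 1 / (1 + x) - 1 + x"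
      using x by (simp add: field_simps)
  qed
  moreover have "0 - 0\<^sup>2 / 2 + 0 ^ 3 / 3 - ln (1 + 0) \<le> h - h\<^sup>2 / 2 + h ^ 3 / 3 - ln (1 + h)"
  proof (rule DERIV_nonneg_imp_nondecreasing[OF assms], rule exI, rule conjI)
    fix x :: real assume x: "0 \<le> x"
    show "((\<lambda>x. x - x\<^sup>2 / 2 + x ^ 3 / 3 - ln (1 + x)) has_real_derivative (1 - x + x\<^sup>2 - 1 / (1 + x))) (at x)"
      using x by (auto intro!: derivative_eq_intros)
    have "1 - x + x\<^sup>2 - 1 / (1 + x) = x ^ 3 / (1 + x)"
      using x by (simp add: field_simps power2_eq_square power3_eq_cube)
    then show "0 \<le> 1 - x + x\<^sup>2 - 1 / (1 + x)"
      using x by simp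
  qed
  moreover have "0 \<le> h ^ 3" using assms by simp
  ultimately show ?thesis by (simp add: abs_le_iff)
qed

text \<open>Replacing \<open>1 / (m + l)^2\<close> by \<open>1 / ((m + l) (m + l + 1))\<close> makes
  the sum telescope to the closed form, and each replacement costs at most
  \<open>1 / m^3\<close>.\<close>

lemma sum_inverse_squares_approx:
  assumes "m > 0"
  shows "\<bar>(\<Sum>l<L. (1 / real (m + l))\<^sup>2) - real L / (real m * real (m + L))\<bar> \<le> real L / real m ^ 3"
proof -
  have "(\<Sum>l<L. 1 / real (m + l) - 1 / real (m + Suc l)) = 1 / real (m + 0) - 1 / real (m + L)"
    by (rule sum_lessThan_telescope')
  also have "\<dots> = real L / (real m * real (m + L))"
    using assms by (simp add: field_simps)
  finally have tele: "real L / (real m * real (m + L)) = (\<Sum>l<L. 1 / real (m + l) - 1 / real (m + Suc l))" ..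
  have "\<bar>(1 / real (m + l))\<^sup>2 - (1 / real (m + l) - 1 / real (m + Suc l))\<bar> \<le> 1 / real m ^ 3" for l
  proof -
    have "(1 / real (m + l))\<^sup>2 - (1 / real (m + l) - 1 / real (m + Suc l))
        = 1 / ((real (m + l))\<^sup>2 * real (m + Suc l))"
      using assms by (simp add: divide_simps power2_eq_square)
    moreover have "real m ^ 3 \<le> (real (m + l))\<^sup>2 * real (m + Suc l)"
      unfolding power3_eq_cube power2_eq_square by (intro mult_mono) auto
    then have "1 / ((real (m + l))\<^sup>2 * real (m + Suc l)) \<le> 1 / real m ^ 3"
      using assms by (intro divide_left_mono) auto
    ultimately show ?thesis by simp
  qed
  then have "(\<Sum>l<L. \<bar>(1 / real (m + l))\<^sup>2 - (1 / real (m + l) - 1 / real (m + Suc l))\<bar>) \<le> (\<Sum>l<L. 1 / real m ^ 3)"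
    by (intro sum_mono)
  then show ?thesis
    unfolding tele sum_subtractf[symmetric] by (intro order.trans[OF sum_abs]) simp
qed

text \<open>The logarithm telescopes into the terms \<open>ln (1 + 1 / (m + l))\<close>, each of
  which is expanded to second order. The half sum of squares is what survives in
  \<open>mean_lim\<close>.\<close>

lemma sum_inverses_approx:
  assumes "m > 0"
  shows "\<bar>(\<Sum>l<L. 1 / real (m + l)) - ln (real (m + L) / real m) - (\<Sum>l<L. (1 / real (m + l))\<^sup>2) / 2\<bar>
    \<le> real L / real m ^ 3"
proof -
  have "ln (1 + 1 / real (m + l)) = ln (real (m + Suc l)) - ln (real (m + l))" for l
  proof -
    have "1 + 1 / real (m + l) = real (m + Suc l) / real (m + l)"
      using assms by (simp add: field_simps)
    then show ?thesis using assms by (simp add: ln_div)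
  qed
  then have "(\<Sum>l<L. ln (1 + 1 / real (m + l))) = ln (real (m + L)) - ln (real (m + 0))"
    using sum_lessThan_telescope[of "\<lambda>l. ln (real (m + l))" L] by simp
  then have tele: "ln (real (m + L) / real m) = (\<Sum>l<L. ln (1 + 1 / real (m + l)))"
    using assms by (simp add: ln_div)
  have "\<bar>1 / real (m + l) - ln (1 + 1 / real (m + l)) - (1 / real (m + l))\<^sup>2 / 2\<bar> \<le> 1 / real m ^ 3" for l
  proof -
    have "1 / real (m + l) \<le> 1 / real m"
      using assms by (intro divide_left_mono) auto
    then have "(1 / real (m + l)) ^ 3 \<le> (1 / real m) ^ 3"
      by (rule power_mono) simp
    then show ?thesis
      using ln_one_plus_quadratic_bound[of "1 / real (m + l)"] by (simp add: power_one_over)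
  qed
  then have "(\<Sum>l<L. \<bar>1 / real (m + l) - ln (1 + 1 / real (m + l)) - (1 / real (m + l))\<^sup>2 / 2\<bar>) \<le> (\<Sum>l<L. 1 / real m ^ 3)"
    by (intro sum_mono)
  then show ?thesis
    unfolding tele sum_divide_distrib sum_subtractf[symmetric] by (intro order.trans[OF sum_abs]) simp
qed

text \<open>\<open>1 / (1 - \<i> x)\<close> is the characteristic function of an exponential
  variable and \<open>iexp (- x)\<close> centres it, so it agrees to second order with its Gaussian
  counterpart.\<close>

lemma exponential_factor_approx:
  fixes x :: real
  assumes "\<bar>x\<bar> \<le> 1"
  shows "norm (iexp (- x) / (1 - \<i> * of_real x) - of_real (exp (- x\<^sup>2 / 2))) \<le> 2 * \<bar>x\<bar> ^ 3"
proof -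
  define E1 where "E1 = iexp (- x) - (1 - \<i> * of_real x - of_real (x\<^sup>2 / 2))"
  define E2 where "E2 = exp (- x\<^sup>2 / 2) - (1 - x\<^sup>2 / 2)"
  have sum2: "(\<Sum>k\<le>2. (\<i> * complex_of_real (- x)) ^ k / fact k) = 1 - \<i> * of_real x - of_real (x\<^sup>2 / 2)"
    by (simp add: numeral_2_eq_2 complex_eq_iff)
  have "norm E1 \<le> \<bar>x\<bar> ^ 3 / 6"
    using iexp_approx1[of "- x" 2] unfolding E1_def sum2 by (simp add: fact_numeral eval_nat_numeral)
  moreover have "\<bar>E2\<bar> \<le> \<bar>x\<bar> ^ 3 / 4"
  proof -
    have "0 \<le> E2"
      using exp_ge_add_one_self[of "- x\<^sup>2 / 2"] by (simp add: E2_def)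
    \<comment> \<open>With \<open>y = x^2 / 2\<close>, the chain is
      \<open>exp (- y) \<le> 1 / (1 + y) \<le> 1 - y + y^2\<close>.\<close>
    moreover have "E2 \<le> (x\<^sup>2 / 2)\<^sup>2"
    proof -
      have "1 + x\<^sup>2 / 2 \<le> exp (x\<^sup>2 / 2)" by (rule exp_ge_add_one_self)
      then have "exp (- x\<^sup>2 / 2) \<le> 1 / (1 + x\<^sup>2 / 2)"
        by (simp add: exp_minus field_simps add_pos_nonneg)
      also have "\<dots> \<le> 1 - x\<^sup>2 / 2 + (x\<^sup>2 / 2)\<^sup>2"
      proof -
        have "0 \<le> (x\<^sup>2 / 2) ^ 3" by simp
        then have "1 \<le> (1 - x\<^sup>2 / 2 + (x\<^sup>2 / 2)\<^sup>2) * (1 + x\<^sup>2 / 2)"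
          by (simp only: algebra_simps power2_eq_square power3_eq_cube)
        moreover have "0 < 1 + x\<^sup>2 / 2" by (simp add: add_pos_nonneg)
        ultimately show ?thesis by (simp add: pos_divide_le_eq)
      qed
      finally show ?thesis by (simp add: E2_def)
    qed
    moreover have "(x\<^sup>2 / 2)\<^sup>2 \<le> \<bar>x\<bar> ^ 3 / 4"
    proof -
      have "\<bar>x\<bar> ^ 4 \<le> \<bar>x\<bar> ^ 3"
        using assms by (intro power_decreasing) auto
      then show ?thesis by (simp add: power_divide)
    qed
    ultimately show ?thesis by simp
  qed
  moreover have n2: "norm (1 - \<i> * of_real x) \<le> 2"
    using assms by (intro order.trans[OF norm_triangle_ineq4]) (simp add: norm_mult)
  \<comment> \<open>With the denominator cleared, \<open>(1 - \<i> x) (1 - x^2 / 2)\<close> leaves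
    the cubic term \<open>\<i> x^3 / 2\<close>. The three errors have coefficients
    \<open>1/6\<close>, \<open>1/2\<close> and \<open>2/4\<close>, in total below
    \<open>2\<close>.\<close>
  have "iexp (- x) - (1 - \<i> * of_real x) * of_real (exp (- x\<^sup>2 / 2))
      = E1 - \<i> * of_real (x ^ 3 / 2) - (1 - \<i> * of_real x) * of_real E2"
    by (simp add: E1_def E2_def algebra_simps power2_eq_square power3_eq_cube diff_divide_distrib)
  moreover have "norm (E1 - \<i> * of_real (x ^ 3 / 2) - (1 - \<i> * of_real x) * of_real E2)
      \<le> norm E1 + \<bar>x\<bar> ^ 3 / 2 + norm (1 - \<i> * of_real x) * \<bar>E2\<bar>"
    by (intro order.trans[OF norm_triangle_ineq4] add_mono order.trans[OF norm_triangle_ineq4])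
      (simp_all add: norm_mult norm_power power_abs flip: of_real_power)
  moreover have "norm (1 - \<i> * of_real x) * \<bar>E2\<bar> \<le> 2 * \<bar>E2\<bar>"
    using n2 by (rule mult_right_mono) simp
  ultimately have num: "norm (iexp (- x) - (1 - \<i> * of_real x) * of_real (exp (- x\<^sup>2 / 2))) \<le> 2 * \<bar>x\<bar> ^ 3"
    by simp
  have ge1: "norm (1 - \<i> * of_real x) \<ge> 1"
    by (simp add: norm_one_minus_ii)
  then have nz: "1 - \<i> * of_real x \<noteq> 0" by auto
  have "norm (iexp (- x) / (1 - \<i> * of_real x) - of_real (exp (- x\<^sup>2 / 2)))
      = norm (iexp (- x) - (1 - \<i> * of_real x) * of_real (exp (- x\<^sup>2 / 2))) / norm (1 - \<i> * of_real x)"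
    using nz by (simp add: norm_divide[symmetric] diff_divide_distrib)
  also have "\<dots> \<le> norm (iexp (- x) - (1 - \<i> * of_real x) * of_real (exp (- x\<^sup>2 / 2))) / 1"
    using ge1 by (intro divide_left_mono) auto
  finally show ?thesis using num by simp
qed

lemma gaussian_fourier_integral:
  assumes "\<beta> > 0"
  shows "(LINT t|lborel. of_real (exp (- \<beta> * t\<^sup>2 / 2)) * iexp (t * s)) = of_real (sqrt (2 * pi / \<beta>) * exp (- s\<^sup>2 / (2 * \<beta>)))"
proof -
  define r where "r = sqrt \<beta>"
  have r: "r > 0" "r\<^sup>2 = \<beta>" using assms by (auto simp: r_def)
  have "of_real (exp (- (s / r)\<^sup>2 / 2)) = char std_normal_distribution (s / r)"
    by (simp add: char_std_normal_distribution)
  also have "\<dots> = (LINT x|lborel. std_normal_density x *\<^sub>R iexp (s / r * x))"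
    unfolding char_def by (subst integral_density) auto
  also have "\<dots> = r *\<^sub>R (LINT x|lborel. std_normal_density (0 + r * x) *\<^sub>R iexp (s / r * (0 + r * x)))"
    using r by (subst lborel_integral_real_affine[of r _ 0]) auto
  also have "(\<lambda>x. std_normal_density (0 + r * x) *\<^sub>R iexp (s / r * (0 + r * x)))
      = (\<lambda>t. of_real (1 / sqrt (2 * pi)) * (of_real (exp (- \<beta> * t\<^sup>2 / 2)) * iexp (t * s)))"
    using r by (intro ext) (simp add: std_normal_density_def scaleR_conv_of_real power_mult_distrib mult_ac)
  finally have "of_real (exp (- (s / r)\<^sup>2 / 2)) =
      of_real (r / sqrt (2 * pi)) * (LINT t|lborel. of_real (exp (- \<beta> * t\<^sup>2 / 2)) * iexp (t * s))"
    by (simp add: scaleR_conv_of_real)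
  then have "(LINT t|lborel. of_real (exp (- \<beta> * t\<^sup>2 / 2)) * iexp (t * s)) =
      of_real (exp (- (s / r)\<^sup>2 / 2)) / of_real (r / sqrt (2 * pi))"
    using r by (simp add: field_simps)
  also have "\<dots> = of_real (exp (- (s / r)\<^sup>2 / 2) / (r / sqrt (2 * pi)))" by simp
  also have "exp (- (s / r)\<^sup>2 / 2) / (r / sqrt (2 * pi)) = sqrt (2 * pi / \<beta>) * exp (- s\<^sup>2 / (2 * \<beta>))"
    using r by (simp add: power_divide real_sqrt_divide r_def)
  finally show ?thesis .
qed

text \<open>\<open>m\<close> is kept abstract, with \<open>m / N\<close> tending to
  \<open>p\<close>, so that bulk and edge share these limits and differ only in the growth of
  \<open>N - m\<close>. In the application \<open>p = 1 - q\<close>.\<close>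

locale critical_regime =
  fixes M N L m :: "nat \<Rightarrow> nat" and \<gamma> \<tau> p :: real
  assumes M_pos: "M k > 0" and N_pos: "N k > 0" and L_pos: "L k > 0" and m_pos: "m k > 0"
    and \<gamma>_pos: "\<gamma> > 0" and \<tau>_pos: "\<tau> > 0" and p_pos: "p > 0"
    and N_lim: "filterlim N at_top sequentially"
    and M_lim: "(\<lambda>k. real (M k) / real (N k)) \<longlonglongrightarrow> \<gamma>"
    and L_lim: "(\<lambda>k. real (L k) / real (N k)) \<longlonglongrightarrow> \<tau>"
    and m_lim: "(\<lambda>k. real (m k) / real (N k)) \<longlonglongrightarrow> p"
begin

definition "\<beta> = \<gamma> * \<tau> / (p * (p + \<tau>))"

lemma \<beta>_pos: "\<beta> > 0"
  using \<gamma>_pos \<tau>_pos p_pos by (simp add: \<beta>_def)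

lemma real_N_lim: "filterlim (\<lambda>k. real (N k)) at_top sequentially"
  using N_lim filterlim_real_sequentially filterlim_compose by blast

lemma inverse_N_lim: "(\<lambda>k. inverse (real (N k))) \<longlonglongrightarrow> 0"
  by (rule tendsto_inverse_0_at_top[OF real_N_lim])

lemma filterlim_proportional:
  fixes A :: "nat \<Rightarrow> nat"
  assumes "(\<lambda>k. real (A k) / real (N k)) \<longlonglongrightarrow> a" "a > 0"
  shows "filterlim A at_top sequentially"
proof -
  have "filterlim (\<lambda>k. real (A k) / real (N k) * real (N k)) at_top sequentially"
    by (rule filterlim_tendsto_pos_mult_at_top[OF assms real_N_lim])
  then have "filterlim (\<lambda>k. real (A k)) at_top sequentially"
    using N_pos by (simp add: less_imp_neq[symmetric])
  then show ?thesis
    unfolding filterlim_at_top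
    by (metis (mono_tags, lifting) eventually_mono of_nat_le_iff)
qed

lemma rate_lim: "(\<lambda>k. real (M k) * (real (L k) / (real (m k) * real (m k + L k)))) \<longlonglongrightarrow> \<beta>"
proof -
  have "(\<lambda>k. real (M k) / real (N k) * (real (L k) / real (N k)) /
      (real (m k) / real (N k) * (real (m k) / real (N k) + real (L k) / real (N k)))) \<longlonglongrightarrow> \<beta>"
    unfolding \<beta>_def by (intro tendsto_intros M_lim L_lim m_lim) (use p_pos \<tau>_pos in auto)
  moreover have "real (M k) / real (N k) * (real (L k) / real (N k)) /
      (real (m k) / real (N k) * (real (m k) / real (N k) + real (L k) / real (N k)))
      = real (M k) * (real (L k) / (real (m k) * real (m k + L k)))" for k
    using N_pos[of k] m_pos[of k] by (simp add: field_simps)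
  ultimately show ?thesis by simp
qed

text \<open>\<open>M L / m^3\<close> is of order \<open>1 / N\<close>. It bounds the third-order
  errors in the variance, the mean and the Gaussian approximation.\<close>

lemma cubic_lim: "(\<lambda>k. real (M k) * (real (L k) / real (m k) ^ 3)) \<longlonglongrightarrow> 0"
proof -
  have "(\<lambda>k. real (M k) / real (N k) * (real (L k) / real (N k)) /
      (real (m k) / real (N k)) ^ 3 * inverse (real (N k))) \<longlonglongrightarrow> \<gamma> * \<tau> / p ^ 3 * 0"
    by (intro tendsto_intros M_lim L_lim m_lim inverse_N_lim) (use p_pos in auto)
  moreover have "real (M k) / real (N k) * (real (L k) / real (N k)) /
      (real (m k) / real (N k)) ^ 3 * inverse (real (N k)) = real (M k) * (real (L k) / real (m k) ^ 3)" for k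
    using N_pos[of k] m_pos[of k] by (simp add: field_simps power3_eq_cube)
  ultimately show ?thesis by simp
qed

lemma variance_lim: "(\<lambda>k. real (M k) * (\<Sum>l<L k. (1 / real (m k + l))\<^sup>2)) \<longlonglongrightarrow> \<beta>"
proof -
  have "(\<lambda>k. real (M k) * (\<Sum>l<L k. (1 / real (m k + l))\<^sup>2)
      - real (M k) * (real (L k) / (real (m k) * real (m k + L k)))) \<longlonglongrightarrow> 0"
  proof (rule Lim_null_comparison[OF always_eventually cubic_lim], rule allI)
    fix k
    show "norm (real (M k) * (\<Sum>l<L k. (1 / real (m k + l))\<^sup>2)
        - real (M k) * (real (L k) / (real (m k) * real (m k + L k)))) \<le> real (M k) * (real (L k) / real (m k) ^ 3)"
      unfolding right_diff_distrib[symmetric] real_norm_def abs_mult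
      using mult_left_mono[OF sum_inverse_squares_approx[OF m_pos[of k], of "L k"], of "real (M k)"]
      by simp
  qed
  from tendsto_add[OF this rate_lim] show ?thesis by simp
qed

text \<open>The mean itself diverges. Its leading part \<open>M ln ((m + L) / m)\<close> is
  \<open>- 2 ln |u ^ M|\<close>, so the base point absorbs the divergence; half the variance is
  left.\<close>

lemma mean_lim:
  "(\<lambda>k. real (M k) * (\<Sum>l<L k. 1 / real (m k + l)) - real (M k) * ln (real (m k + L k) / real (m k))) \<longlonglongrightarrow> \<beta> / 2"
proof -
  have "(\<lambda>k. (real (M k) * (\<Sum>l<L k. 1 / real (m k + l)) - real (M k) * ln (real (m k + L k) / real (m k)))
      - real (M k) * (\<Sum>l<L k. (1 / real (m k + l))\<^sup>2) / 2) \<longlonglongrightarrow> 0"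
  proof (rule Lim_null_comparison[OF always_eventually cubic_lim], rule allI)
    fix k
    have eq: "(real (M k) * (\<Sum>l<L k. 1 / real (m k + l)) - real (M k) * ln (real (m k + L k) / real (m k)))
      - real (M k) * (\<Sum>l<L k. (1 / real (m k + l))\<^sup>2) / 2
      = real (M k) * ((\<Sum>l<L k. 1 / real (m k + l)) - ln (real (m k + L k) / real (m k))
          - (\<Sum>l<L k. (1 / real (m k + l))\<^sup>2) / 2)"
      by (simp only: right_diff_distrib times_divide_eq_right)
    show "norm ((real (M k) * (\<Sum>l<L k. 1 / real (m k + l)) - real (M k) * ln (real (m k + L k) / real (m k)))
      - real (M k) * (\<Sum>l<L k. (1 / real (m k + l))\<^sup>2) / 2) \<le> real (M k) * (real (L k) / real (m k) ^ 3)"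
      unfolding eq real_norm_def abs_mult
      using mult_left_mono[OF sum_inverses_approx[OF m_pos[of k], of "L k"], of "real (M k)"]
      by simp
  qed
  from tendsto_add[OF this tendsto_divide[OF variance_lim tendsto_const[of 2]]] show ?thesis by simp
qed

text \<open>A central limit theorem in Fourier form. After centring, each factor is replaced by its
  Gaussian counterpart; as all of them have modulus at most \<open>1\<close>, the errors merely add
  up, to at most \<open>2 M L |t|^3 / m^3\<close>.\<close>

lemma exponential_char_lim:
  assumes y: "(\<lambda>k. real (M k) * (\<Sum>l<L k. 1 / real (m k + l)) + 2 * y k) \<longlonglongrightarrow> s"
  shows "(\<lambda>k. exponential_char (M k) (L k) (m k) t * exp (2 * \<i> * of_real (t * y k)))
    \<longlonglongrightarrow> of_real (exp (- \<beta> * t\<^sup>2 / 2)) * iexp (t * s)"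
proof -
  define h where "h k l = t / real (m k + l)" for k l
  define Z where "Z k = (\<Prod>l<L k. iexp (- h k l) / (1 - \<i> * of_real (h k l))) ^ M k" for k
  define W where "W k = (\<Prod>l<L k. complex_of_real (exp (- (h k l)\<^sup>2 / 2))) ^ M k" for k
  have W: "W k = of_real (exp (- t\<^sup>2 / 2 * (real (M k) * (\<Sum>l<L k. (1 / real (m k + l))\<^sup>2))))" for k
  proof -
    have "- t\<^sup>2 / 2 * (real (M k) * (\<Sum>l<L k. (1 / real (m k + l))\<^sup>2)) = real (M k) * (\<Sum>l<L k. - (h k l)\<^sup>2 / 2)"
      by (simp add: h_def power_divide sum_distrib_left sum_divide_distrib mult_ac flip: sum_negf)
    then show ?thesis
      by (simp only: W_def exp_of_nat_mult exp_sum finite_lessThan of_real_power of_real_prod)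
  qed
  have W_lim: "W \<longlonglongrightarrow> of_real (exp (- t\<^sup>2 / 2 * \<beta>))"
    unfolding W by (intro tendsto_intros variance_lim)
  have "(\<lambda>k. Z k - W k) \<longlonglongrightarrow> 0"
  proof (rule Lim_null_comparison)
    show "(\<lambda>k. 2 * \<bar>t\<bar> ^ 3 * (real (M k) * (real (L k) / real (m k) ^ 3))) \<longlonglongrightarrow> 0"
      using tendsto_mult[OF tendsto_const cubic_lim, of "2 * \<bar>t\<bar> ^ 3"] by simp
    have "\<forall>\<^sub>F k in sequentially. nat \<lceil>\<bar>t\<bar>\<rceil> \<le> m k"
      using filterlim_proportional[OF m_lim p_pos] unfolding filterlim_at_top by blast
    then show "\<forall>\<^sub>F k in sequentially. norm (Z k - W k) \<le> 2 * \<bar>t\<bar> ^ 3 * (real (M k) * (real (L k) / real (m k) ^ 3))"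
    proof eventually_elim
      case (elim k)
      then have t: "\<bar>t\<bar> \<le> real (m k)" by linarith
      have hm: "\<bar>h k l\<bar> \<le> \<bar>t\<bar> / real (m k)" for l
        using m_pos[of k] unfolding h_def abs_divide by (intro divide_left_mono) auto
      moreover have "\<bar>t\<bar> / real (m k) \<le> 1"
        using t m_pos[of k] by simp
      ultimately have h1: "\<bar>h k l\<bar> \<le> 1" for l
        using order.trans by blast
      have z1: "norm (iexp (- h k l) / (1 - \<i> * of_real (h k l))) \<le> 1" for l
      proof -
        have "1 \<le> sqrt (1 + (h k l)\<^sup>2)" by simp
        moreover from this have "0 < sqrt (1 + (h k l)\<^sup>2)" by linarith
        ultimately show ?thesis
          by (simp only: norm_divide norm_one_minus_ii norm_exp_i_times divide_le_eq_1_pos)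
      qed
      have w1: "norm (complex_of_real (exp (- (h k l)\<^sup>2 / 2))) \<le> 1" for l
        by simp
      have Z1: "norm (\<Prod>l<L k. iexp (- h k l) / (1 - \<i> * of_real (h k l))) \<le> 1"
        by (subst prod_norm[symmetric], rule prod_le_1, rule conjI[OF norm_ge_zero z1])
      have W1: "norm (\<Prod>l<L k. complex_of_real (exp (- (h k l)\<^sup>2 / 2))) \<le> 1"
        by (subst prod_norm[symmetric], rule prod_le_1, rule conjI[OF norm_ge_zero w1])
      have "norm (Z k - W k) \<le> real (M k) * norm ((\<Prod>l<L k. iexp (- h k l) / (1 - \<i> * of_real (h k l)))
          - (\<Prod>l<L k. of_real (exp (- (h k l)\<^sup>2 / 2))))"
        unfolding Z_def W_def
        by (rule norm_power_diff[OF Z1 W1])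
      also have "\<dots> \<le> real (M k) * (\<Sum>l<L k. norm (iexp (- h k l) / (1 - \<i> * of_real (h k l)) - of_real (exp (- (h k l)\<^sup>2 / 2))))"
        by (intro mult_left_mono norm_prod_diff z1 w1) auto
      also have "\<dots> \<le> real (M k) * (\<Sum>l<L k. 2 * (\<bar>t\<bar> / real (m k)) ^ 3)"
      proof (intro mult_left_mono sum_mono)
        fix l
        have "norm (iexp (- h k l) / (1 - \<i> * of_real (h k l)) - of_real (exp (- (h k l)\<^sup>2 / 2))) \<le> 2 * \<bar>h k l\<bar> ^ 3"
          by (rule exponential_factor_approx[OF h1])
        also have "\<dots> \<le> 2 * (\<bar>t\<bar> / real (m k)) ^ 3"
          by (intro mult_left_mono power_mono hm) auto
        finally show "norm (iexp (- h k l) / (1 - \<i> * of_real (h k l)) - of_real (exp (- (h k l)\<^sup>2 / 2))) \<le> 2 * (\<bar>t\<bar> / real (m k)) ^ 3" .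
      qed simp
      finally show ?case by (simp add: power_divide mult_ac)
    qed
  qed
  from tendsto_add[OF this W_lim] have Z_lim: "Z \<longlonglongrightarrow> of_real (exp (- t\<^sup>2 / 2 * \<beta>))" by simp
  have "exponential_char (M k) (L k) (m k) t * exp (2 * \<i> * of_real (t * y k))
      = Z k * iexp (t * (real (M k) * (\<Sum>l<L k. 1 / real (m k + l)) + 2 * y k))" for k
  proof -
    have "(\<Prod>l<L k. iexp (- h k l)) ^ M k = exp (\<Sum>l<L k. \<i> * of_real (- h k l)) ^ M k"
      by (simp only: exp_sum finite_lessThan)
    also have "\<dots> = iexp (- t * (real (M k) * (\<Sum>l<L k. 1 / real (m k + l))))"
      unfolding exp_of_nat_mult[symmetric]
      by (rule arg_cong[of _ _ exp]) (simp add: h_def sum_distrib_left sum_negf mult_ac)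
    finally have "Z k = iexp (- t * (real (M k) * (\<Sum>l<L k. 1 / real (m k + l)))) * exponential_char (M k) (L k) (m k) t"
      by (simp add: Z_def exponential_char_def h_def prod_dividef power_divide)
    then have "Z k * iexp (t * (real (M k) * (\<Sum>l<L k. 1 / real (m k + l)) + 2 * y k)) =
        exponential_char (M k) (L k) (m k) t * (iexp (- t * (real (M k) * (\<Sum>l<L k. 1 / real (m k + l))))
          * iexp (t * (real (M k) * (\<Sum>l<L k. 1 / real (m k + l)) + 2 * y k)))"
      by (simp only: mult_ac)
    also have "iexp (- t * (real (M k) * (\<Sum>l<L k. 1 / real (m k + l))))
          * iexp (t * (real (M k) * (\<Sum>l<L k. 1 / real (m k + l)) + 2 * y k)) = exp (2 * \<i> * of_real (t * y k))"
      unfolding mult_exp_exp by (rule arg_cong[of _ _ exp]) (simp add: algebra_simps)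
    finally show ?thesis ..
  qed
  moreover have "(\<lambda>k. Z k * iexp (t * (real (M k) * (\<Sum>l<L k. 1 / real (m k + l)) + 2 * y k)))
      \<longlonglongrightarrow> of_real (exp (- t\<^sup>2 / 2 * \<beta>)) * iexp (t * s)"
    by (intro tendsto_intros Z_lim y)
  ultimately show ?thesis by (simp add: mult.commute)
qed

text \<open>Both \<open>M L\<close> and \<open>(m + L)^2\<close> grow like \<open>N^2\<close>, so
  the coefficient in \<open>norm_exponential_char_le\<close> stays above half its limiting lower
  bound. That \<open>M * L\<close> is at least \<open>2\<close> comes along, since a positive lower
  bound forces \<open>M * L div 2\<close> to be nonzero.\<close>

lemma domination_constant:
  obtains \<kappa> where "\<kappa> > 0"
    "\<forall>\<^sub>F k in sequentially. M k * L k \<ge> 2 \<and> \<kappa> \<le> real (M k * L k div 2) / (real (m k + L k))\<^sup>2"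
proof -
  define a where "a = \<gamma> * \<tau> / 2 / (p + \<tau>)\<^sup>2"
  have a: "a > 0" using \<gamma>_pos \<tau>_pos p_pos by (simp add: a_def)
  \<comment> \<open>The subtracted square of \<open>inverse (real (N k))\<close> pays for the
    rounding: \<open>(M L - 1) / 2\<close> is at most \<open>M L div 2\<close>.\<close>
  have "(\<lambda>k. (real (M k) / real (N k) * (real (L k) / real (N k)) - (inverse (real (N k)))\<^sup>2) / 2 /
      (real (m k) / real (N k) + real (L k) / real (N k))\<^sup>2) \<longlonglongrightarrow> (\<gamma> * \<tau> - 0\<^sup>2) / 2 / (p + \<tau>)\<^sup>2"
    by (intro tendsto_intros M_lim L_lim m_lim inverse_N_lim) (use p_pos \<tau>_pos in auto)
  then have "(\<lambda>k. (real (M k) / real (N k) * (real (L k) / real (N k)) - (inverse (real (N k)))\<^sup>2) / 2 /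
      (real (m k) / real (N k) + real (L k) / real (N k))\<^sup>2) \<longlonglongrightarrow> a"
    by (simp add: a_def)
  moreover have "(real (M k) / real (N k) * (real (L k) / real (N k)) - (inverse (real (N k)))\<^sup>2) / 2 /
      (real (m k) / real (N k) + real (L k) / real (N k))\<^sup>2 = (real (M k * L k) - 1) / 2 / (real (m k + L k))\<^sup>2" for k
  proof -
    have "real (m k) / real (N k) + real (L k) / real (N k) = real (m k + L k) / real (N k)"
      by (simp add: add_divide_distrib)
    moreover have "real (M k) / real (N k) * (real (L k) / real (N k)) - (inverse (real (N k)))\<^sup>2
        = (real (M k * L k) - 1) / (real (N k))\<^sup>2"
      using N_pos[of k] by (simp add: power2_eq_square divide_simps)
    ultimately show ?thesis
      using N_pos[of k] by (simp add: power_divide)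
  qed
  ultimately have "(\<lambda>k. (real (M k * L k) - 1) / 2 / (real (m k + L k))\<^sup>2) \<longlonglongrightarrow> a" by simp
  then have "\<forall>\<^sub>F k in sequentially. a / 2 < (real (M k * L k) - 1) / 2 / (real (m k + L k))\<^sup>2"
    by (rule order_tendstoD) (use a in simp)
  then have "\<forall>\<^sub>F k in sequentially. M k * L k \<ge> 2 \<and> a / 2 \<le> real (M k * L k div 2) / (real (m k + L k))\<^sup>2"
  proof eventually_elim
    case (elim k)
    have "M k * L k \<le> 2 * (M k * L k div 2) + 1"
      by presburger
    then have "real (M k * L k) \<le> real (2 * (M k * L k div 2) + 1)"
      by (rule of_nat_mono)
    then have "(real (M k * L k) - 1) / 2 \<le> real (M k * L k div 2)"
      by simp
    then have "(real (M k * L k) - 1) / 2 / (real (m k + L k))\<^sup>2 \<le> real (M k * L k div 2) / (real (m k + L k))\<^sup>2"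
      by (rule divide_right_mono) simp
    with elim have le: "a / 2 < real (M k * L k div 2) / (real (m k + L k))\<^sup>2" by linarith
    have "M k * L k div 2 \<noteq> 0"
    proof
      assume "M k * L k div 2 = 0"
      with le a show False by simp
    qed
    with le show ?case by simp
  qed
  then show ?thesis
    using that[of "a / 2"] a by simp
qed

lemma exponential_density_lim:
  assumes y: "(\<lambda>k. real (M k) * (\<Sum>l<L k. 1 / real (m k + l)) + 2 * y k) \<longlonglongrightarrow> s"
  shows "(\<lambda>k. LINT t|lborel. exponential_char (M k) (L k) (m k) t * exp (2 * \<i> * of_real (t * y k)))
    \<longlonglongrightarrow> of_real (sqrt (2 * pi / \<beta>) * exp (- s\<^sup>2 / (2 * \<beta>)))"
proof -
  obtain \<kappa> where \<kappa>: "\<kappa> > 0"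
    "\<forall>\<^sub>F k in sequentially. M k * L k \<ge> 2 \<and> \<kappa> \<le> real (M k * L k div 2) / (real (m k + L k))\<^sup>2"
    by (rule domination_constant)
  then obtain k0 where k0: "\<And>k. k \<ge> k0 \<Longrightarrow> M k * L k \<ge> 2"
    "\<And>k. k \<ge> k0 \<Longrightarrow> \<kappa> \<le> real (M k * L k div 2) / (real (m k + L k))\<^sup>2"
    unfolding eventually_sequentially by blast
  let ?f = "\<lambda>k t. exponential_char (M k) (L k) (m k) t * exp (2 * \<i> * of_real (t * y k))"
  have meas: "?f (k + k0) \<in> borel_measurable lborel" for k
    by (rule borel_measurable_integrable[OF integrable_exponential_char[OF m_pos k0(1)]]) simp
  have "(\<lambda>k. LINT t|lborel. ?f (k + k0) t) \<longlonglongrightarrow> (LINT t|lborel. of_real (exp (- \<beta> * t\<^sup>2 / 2)) * iexp (t * s))"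
  proof (rule integral_dominated_convergence[where w = "\<lambda>t. 1 / (1 + \<kappa> * t\<^sup>2)"])
    show "integrable lborel (\<lambda>t. 1 / (1 + \<kappa> * t\<^sup>2))"
      using \<kappa>(1) by (rule integrable_inverse_one_plus_square)
    show "AE t in lborel. (\<lambda>k. ?f (k + k0) t) \<longlonglongrightarrow> of_real (exp (- \<beta> * t\<^sup>2 / 2)) * iexp (t * s)"
      by (rule AE_I2) (rule LIMSEQ_ignore_initial_segment[OF exponential_char_lim[OF y]])
    show "AE t in lborel. norm (?f (k + k0) t) \<le> 1 / (1 + \<kappa> * t\<^sup>2)" for k
    proof (rule AE_I2)
      fix t
      have "1 + \<kappa> * t\<^sup>2 \<le> 1 + real (M (k + k0) * L (k + k0) div 2) / (real (m (k + k0) + L (k + k0)))\<^sup>2 * t\<^sup>2"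
        by (intro add_left_mono mult_right_mono k0(2)) auto
      then have "1 / (1 + real (M (k + k0) * L (k + k0) div 2) / (real (m (k + k0) + L (k + k0)))\<^sup>2 * t\<^sup>2) \<le> 1 / (1 + \<kappa> * t\<^sup>2)"
        using \<kappa>(1) by (intro divide_left_mono) (auto intro!: mult_pos_pos add_pos_nonneg)
      then show "norm (?f (k + k0) t) \<le> 1 / (1 + \<kappa> * t\<^sup>2)"
        using norm_exponential_char_le[OF m_pos, of "M (k + k0)" "L (k + k0)" "k + k0" t]
        by (simp add: norm_mult)
    qed
  qed (use meas in auto)
  from LIMSEQ_offset[where f = "\<lambda>k. LINT t|lborel. ?f k t", OF this] show ?thesis
    unfolding gaussian_fourier_integral[OF \<beta>_pos] .
qed

text \<open>A local limit theorem: by Fourier inversion the normalised weight is the density of the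
  sum of exponential variables at \<open>- 2 ln |z|\<close>, a point whose distance below the mean
  tends to \<open>s\<close>. The limit is the centred normal density of variance
  \<open>\<beta>\<close> at \<open>s\<close>.\<close>

lemma weight_lim:
  assumes c: "c > 0" and z: "\<forall>\<^sub>F k in sequentially. z k \<noteq> 0"
    and y: "(\<lambda>k. real (M k) * (\<Sum>l<L k. 1 / real (m k + l)) + 2 * ln (cmod (z k))) \<longlonglongrightarrow> s"
  shows "(\<lambda>k. weight c (M k) (L k) (z k) * of_real ((\<Prod>l<L k. real (m k + l)) ^ M k * cmod (z k) ^ (2 * m k)))
    \<longlonglongrightarrow> of_real (exp (- s\<^sup>2 / (2 * \<beta>)) / sqrt (2 * pi * \<beta>))"
proof -
  obtain \<kappa> where \<kappa>: "\<kappa> > 0"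
    "\<forall>\<^sub>F k in sequentially. M k * L k \<ge> 2 \<and> \<kappa> \<le> real (M k * L k div 2) / (real (m k + L k))\<^sup>2"
    by (rule domination_constant)
  have "(\<lambda>k. (LINT t|lborel. exponential_char (M k) (L k) (m k) t * exp (2 * \<i> * of_real (t * ln (cmod (z k))))) / of_real (2 * pi))
    \<longlonglongrightarrow> of_real (sqrt (2 * pi / \<beta>) * exp (- s\<^sup>2 / (2 * \<beta>))) / of_real (2 * pi)"
    by (intro tendsto_divide tendsto_const exponential_density_lim y) simp
  moreover have "\<forall>\<^sub>F k in sequentially. (LINT t|lborel. exponential_char (M k) (L k) (m k) t *
      exp (2 * \<i> * of_real (t * ln (cmod (z k))))) / of_real (2 * pi) =
      weight c (M k) (L k) (z k) * of_real ((\<Prod>l<L k. real (m k + l)) ^ M k * cmod (z k) ^ (2 * m k))"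
    using z \<kappa>(2) by eventually_elim (rule weight_eq_integral[symmetric], use c m_pos in auto)
  ultimately have "(\<lambda>k. weight c (M k) (L k) (z k) * of_real ((\<Prod>l<L k. real (m k + l)) ^ M k * cmod (z k) ^ (2 * m k)))
    \<longlonglongrightarrow> of_real (sqrt (2 * pi / \<beta>) * exp (- s\<^sup>2 / (2 * \<beta>))) / of_real (2 * pi)"
    by (rule Lim_transform_eventually)
  moreover have "sqrt (2 * pi / \<beta>) * exp (- s\<^sup>2 / (2 * \<beta>)) / (2 * pi) = exp (- s\<^sup>2 / (2 * \<beta>)) / sqrt (2 * pi * \<beta>)"
  proof -
    have "sqrt (2 * pi / \<beta>) * sqrt (2 * pi * \<beta>) = 2 * pi"
    proof -
      have "2 * pi / \<beta> * (2 * pi * \<beta>) = (2 * pi)\<^sup>2"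
        using \<beta>_pos by (simp add: power2_eq_square)
      then show ?thesis
        by (metis real_sqrt_mult real_sqrt_unique pi_ge_zero mult_nonneg_nonneg zero_le_numeral)
    qed
    then show ?thesis
      using \<beta>_pos by (simp add: field_simps)
  qed
  ultimately show ?thesis
    by (simp only: of_real_divide[symmetric])
qed

end

subsection \<open>The kernel sum\<close>

lemma det_unimodular_scale:
  fixes E :: "'n::finite \<Rightarrow> 'n \<Rightarrow> complex"
  assumes "\<And>i. cmod (a i) = 1"
  shows "Determinants.det (\<chi> i j. a i * cnj (a j) * E i j) = Determinants.det (\<chi> i j. E i j)"
proof -
  have "(\<Prod>i\<in>UNIV. a i) * (\<Prod>i\<in>UNIV. cnj (a i)) = (\<Prod>i\<in>UNIV. a i * cnj (a i))"
    by (simp add: prod.distrib)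
  also have "\<dots> = 1"
    using assms by (simp add: complex_norm_square[symmetric])
  finally show ?thesis by (simp add: det_diagonal_scale)
qed

lemma infsum_int_eq_suminf:
  fixes g :: "int \<Rightarrow> complex"
  assumes "summable (\<lambda>k. norm (g (int k)))" "summable (\<lambda>k. norm (g (- int k)))"
  shows "(\<Sum>\<^sub>\<infinity>j\<in>UNIV. g j) = (\<Sum>k. g (- int k)) + (\<Sum>k. g (int k)) - g 0"
proof -
  have pos: "(g has_sum (\<Sum>k. g (int k))) (range int)"
    by (subst has_sum_reindex) (auto simp: o_def intro!: norm_summable_imp_has_sum assms summable_sums summable_norm_cancel[OF assms(1)])
  have s2: "summable (\<lambda>k. norm (g (- int (Suc k))))"
    using assms(2) by (subst summable_Suc_iff)
  have "(g has_sum (\<Sum>k. g (- int (Suc k)))) (range (\<lambda>k. - int (Suc k)))"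
    by (subst has_sum_reindex)
      (auto simp: o_def inj_on_def intro!: norm_summable_imp_has_sum[OF s2, simplified] summable_sums[OF summable_norm_cancel[OF s2, simplified]])
  moreover have "range int \<inter> range (\<lambda>k. - int (Suc k)) = {}"
    by auto
  ultimately have "(g has_sum ((\<Sum>k. g (int k)) + (\<Sum>k. g (- int (Suc k))))) (range int \<union> range (\<lambda>k. - int (Suc k)))"
    by (rule has_sum_Un_disjoint[OF pos])
  moreover have "x \<in> range int \<union> range (\<lambda>k. - int (Suc k))" for x
    by (rule int_cases[of x]) blast+
  then have "range int \<union> range (\<lambda>k. - int (Suc k)) = UNIV"
    by blast
  moreover have "(\<Sum>k. g (- int (Suc k))) = (\<Sum>k. g (- int k)) - g 0"
    using suminf_split_head[OF summable_norm_cancel[OF assms(2)]] by simp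
  ultimately show ?thesis
    by (simp add: infsumI algebra_simps)
qed

text \<open>Both directions start with \<open>F n\<close>, so that they can be treated alike; after
  division by \<open>F n\<close> the correction becomes the \<open>- 1\<close> in
  \<open>reduced_kernel\<close>.\<close>

lemma sum_lessThan_split_both_directions:
  fixes F :: "nat \<Rightarrow> 'a::ab_group_add"
  assumes "n < N"
  shows "(\<Sum>j<N. F j) = (\<Sum>i<N - n. F (n + i)) + (\<Sum>i<Suc n. F (n - i)) - F n"
proof -
  have "(\<Sum>j<n + d. F j) = (\<Sum>i<d. F (n + i)) + (\<Sum>j<n. F j)" for d
    by (induction d) (auto simp: algebra_simps)
  from this[of "N - n"] have "(\<Sum>j<N. F j) = (\<Sum>i<N - n. F (n + i)) + (\<Sum>j<n. F j)"
    using assms by simp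
  also have "(\<Sum>j<n. F j) = (\<Sum>i<n. F (n - Suc i))"
    by (rule sum.nat_diff_reindex[symmetric])
  also have "\<dots> = (\<Sum>i<Suc n. F (n - i)) - F n"
    by (subst sum.lessThan_Suc_shift) simp
  finally show ?thesis by (simp add: algebra_simps)
qed

section \<open>Coefficients of the kernel sum and their consecutive quotients\<close>

definition gamma_ratio :: "nat \<Rightarrow> nat \<Rightarrow> nat \<Rightarrow> real" where
  "gamma_ratio M L j = (fact (L + j) / fact j) ^ M"

lemma gamma_ratio_eq_Gamma:
  "complex_of_real (gamma_ratio M L j) = Gamma (of_nat (L + j + 1)) ^ M / Gamma (of_nat (j + 1)) ^ M"
  using Gamma_fact[of "L + j", where 'a = complex] Gamma_fact[of j, where 'a = complex]
  by (simp add: gamma_ratio_def power_divide add_ac)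

lemma gamma_ratio_pos: "gamma_ratio M L j > 0"
  by (simp add: gamma_ratio_def)

lemma gamma_ratio_Suc:
  "gamma_ratio M L (Suc j) = gamma_ratio M L j * (real (L + Suc j) / real (Suc j)) ^ M"
proof -
  have "fact (L + Suc j) / fact (Suc j) = (fact (L + j) / fact j :: real) * (real (L + Suc j) / real (Suc j))"
    by (simp add: field_simps)
  then show ?thesis by (simp only: gamma_ratio_def power_mult_distrib)
qed

text \<open>At \<open>n = m - 1\<close> this is the constant in \<open>weight_eq_integral\<close>,
  which is why coefficient and weight cancel exactly.\<close>

lemma gamma_ratio_eq_prod: "gamma_ratio M L n = (\<Prod>l<L. real (Suc n + l)) ^ M"
proof -
  have "fact (L + n) / fact n = (\<Prod>l<L. real (Suc n + l))"
    by (induction L) (simp_all add: field_simps)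
  then show ?thesis by (simp add: gamma_ratio_def)
qed

text \<open>Quotient of the consecutive terms with indices \<open>m + s\<close> and \<open>m + s - 1\<close> of the kernel sum at
  argument \<open>(m / (m + L)) ^ M\<close>.  It equals \<open>1\<close> at \<open>s = 0\<close>, so the sum peaks at the indices \<open>m - 1\<close> and \<open>m\<close>.\<close>

definition term_ratio :: "nat \<Rightarrow> nat \<Rightarrow> nat \<Rightarrow> real \<Rightarrow> real" where
  "term_ratio M L m s = ((real m + real L + s) / (real m + s) * (real m / (real m + real L))) ^ M"

text \<open>The splitting of \<open>x\<close> separates two scales:
  \<open>(m / (m + L)) ^ M\<close>, which is \<open>|u| ^ (2 M)\<close>, balances the growth of the
  coefficients inside \<open>term_ratio\<close>, whereas \<open>\<zeta>\<close> will have a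
  limit.\<close>

lemma gamma_ratio_up:
  fixes x \<zeta> :: complex
  assumes m: "m > 0" and x: "x = \<zeta> * of_real ((real m / (real m + real L)) ^ M)"
  shows "of_real (gamma_ratio M L (m - 1 + i)) * x ^ (m - 1 + i) =
    of_real (gamma_ratio M L (m - 1)) * x ^ (m - 1) * ((\<Prod>l<i. of_real (term_ratio M L m (real l))) * \<zeta> ^ i)"
proof (induction i)
  case (Suc i)
  have "gamma_ratio M L (m - 1 + Suc i) = gamma_ratio M L (m - 1 + i) * ((real m + real L + real i) / (real m + real i)) ^ M"
    using gamma_ratio_Suc[of M L "m - 1 + i"] m by (simp add: algebra_simps of_nat_diff)
  then have "of_real (gamma_ratio M L (m - 1 + Suc i)) * x ^ (m - 1 + Suc i) =
      of_real (gamma_ratio M L (m - 1 + i)) * x ^ (m - 1 + i) * (of_real (((real m + real L + real i) / (real m + real i)) ^ M) * x)"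
    by simp
  also have "of_real (((real m + real L + real i) / (real m + real i)) ^ M) * x = of_real (term_ratio M L m (real i)) * \<zeta>"
    by (simp only: x term_ratio_def power_mult_distrib of_real_mult mult_ac)
  finally show ?case by (simp only: Suc) (simp add: mult_ac)
qed simp

text \<open>Going below index \<open>m - 1 - i\<close> divides by the quotient at
  \<open>s = - (i + 1)\<close>. The descent thus begins at \<open>s = - 1\<close> while the ascent
  begins at \<open>s = 0\<close>, an asymmetry that returns as \<open>\<delta> = 1\<close> in
  \<open>down_sum_lim\<close>.\<close>

lemma gamma_ratio_down:
  fixes x \<zeta> :: complex
  assumes m: "m > 0" and x: "x = \<zeta> * of_real ((real m / (real m + real L)) ^ M)" and x0: "x \<noteq> 0"
    and i: "i < m"
  shows "of_real (gamma_ratio M L (m - 1 - i)) * x ^ (m - 1 - i) =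
    of_real (gamma_ratio M L (m - 1)) * x ^ (m - 1) *
      ((\<Prod>l<i. of_real (inverse (term_ratio M L m (- real (Suc l))))) * inverse \<zeta> ^ i)"
  using i
proof (induction i)
  case (Suc i)
  define j where "j = m - 1 - Suc i"
  have j: "m - 1 - i = Suc j" "real m = real j + real (Suc (Suc i))"
    using Suc.prems by (auto simp: j_def)
  have "gamma_ratio M L (Suc j) = gamma_ratio M L j * ((real m + real L - real (Suc i)) / (real m - real (Suc i))) ^ M"
    unfolding gamma_ratio_Suc j(2) by (simp add: add_ac)
  then have "of_real (gamma_ratio M L (Suc j)) * x ^ Suc j =
      of_real (gamma_ratio M L j) * x ^ j * (of_real (((real m + real L - real (Suc i)) / (real m - real (Suc i))) ^ M) * x)"
    by simp
  also have "of_real (((real m + real L - real (Suc i)) / (real m - real (Suc i))) ^ M) * x = of_real (term_ratio M L m (- real (Suc i))) * \<zeta>"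
    unfolding diff_conv_add_uminus by (simp only: x term_ratio_def power_mult_distrib of_real_mult mult_ac)
  finally have step: "of_real (gamma_ratio M L (m - 1 - i)) * x ^ (m - 1 - i) =
      of_real (gamma_ratio M L (m - 1 - Suc i)) * x ^ (m - 1 - Suc i) * (of_real (term_ratio M L m (- real (Suc i))) * \<zeta>)"
    unfolding j(1) j_def[symmetric] .
  \<comment> \<open>The left side of \<open>step\<close> is nonzero, hence so is every factor on its
    right.\<close>
  have nz: "of_real (term_ratio M L m (- real (Suc i))) * \<zeta> \<noteq> 0"
    using step x0 gamma_ratio_pos[of M L "m - 1 - i"] by auto
  then have "of_real (gamma_ratio M L (m - 1 - Suc i)) * x ^ (m - 1 - Suc i) =
      of_real (gamma_ratio M L (m - 1 - i)) * x ^ (m - 1 - i) * inverse (of_real (term_ratio M L m (- real (Suc i))) * \<zeta>)"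
  proof -
    have "b = a * inverse c" if "a = b * c" "c \<noteq> 0" for a b c :: complex
      using that by simp
    from this[OF step nz] show ?thesis .
  qed
  then show ?case
    using Suc.IH Suc.prems by (simp add: mult_ac)
qed simp

text \<open>With \<open>x = m + s\<close> the dependence on \<open>s\<close> is through
  \<open>1 + L / x\<close>, which decreases in \<open>x\<close>.\<close>

lemma term_ratio_up_props:
  assumes "m > 0" "l \<le> l'"
  shows "0 \<le> term_ratio M L m (real l)" "term_ratio M L m (real l') \<le> term_ratio M L m (real l)"
proof -
  show "0 \<le> term_ratio M L m (real l)" by (simp add: term_ratio_def)
  have "(real m + real L + real l') / (real m + real l') \<le> (real m + real L + real l) / (real m + real l)"
    using assms by (simp add: divide_simps) (simp add: algebra_simps mult_left_mono)
  then show "term_ratio M L m (real l') \<le> term_ratio M L m (real l)"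
    unfolding term_ratio_def by (intro power_mono mult_right_mono) auto
qed

text \<open>With \<open>x = m - (l + 1)\<close> the dependence is through
  \<open>x / (x + L)\<close>, which increases in \<open>x\<close> and so decreases in
  \<open>l\<close>. At the last index \<open>x = 0\<close>; the convention for division by zero
  keeps the formula \<open>inv\<close> valid there.\<close>

lemma term_ratio_down_props:
  assumes "l \<le> l'" "l' < m"
  shows "0 \<le> inverse (term_ratio M L m (- real (Suc l)))"
    "inverse (term_ratio M L m (- real (Suc l'))) \<le> inverse (term_ratio M L m (- real (Suc l)))"
proof -
  have inv: "inverse (term_ratio M L m (- real (Suc l))) =
      ((real m - real (Suc l)) / (real m + real L - real (Suc l)) * ((real m + real L) / real m)) ^ M" for l
  proof -
    have "inverse ((a / b * (c / d)) ^ M) = (b / a * (d / c)) ^ M" for a b c d :: real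
      by (simp flip: power_inverse)
    then show ?thesis
      unfolding term_ratio_def diff_conv_add_uminus .
  qed
  have "0 \<le> real m - real (Suc l)"
    using assms by simp
  then show "0 \<le> inverse (term_ratio M L m (- real (Suc l)))"
    unfolding inv by (intro zero_le_power mult_nonneg_nonneg divide_nonneg_nonneg) auto
  define a where "a = real m - real (Suc l)"
  define b where "b = real m - real (Suc l')"
  have ab: "0 \<le> b" "b \<le> a" using assms by (auto simp: a_def b_def)
  have "b / (b + real L) \<le> a / (a + real L)"
  \<comment> \<open>The sum vanishes only for \<open>L = 0\<close> and \<open>l' = m - 1\<close>,
    where the left side is \<open>0 / 0 = 0\<close>.\<close>
  proof (cases "b + real L = 0")
    case False
    then have "b + real L > 0" "a + real L > 0" using ab by auto
    then show ?thesis
      using ab by (simp add: divide_simps) (simp add: algebra_simps mult_left_mono mult_right_mono)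
  qed (use ab in simp)
  moreover have "b + real L = real m + real L - real (Suc l')" "a + real L = real m + real L - real (Suc l)"
    by (auto simp: a_def b_def)
  ultimately show "inverse (term_ratio M L m (- real (Suc l'))) \<le> inverse (term_ratio M L m (- real (Suc l)))"
    unfolding inv a_def[symmetric] b_def[symmetric] using ab
    by (intro power_mono mult_right_mono mult_nonneg_nonneg divide_nonneg_nonneg) auto
qed

section \<open>Limits of the quotients, of the local factors and of the two half-sums\<close>

context critical_regime
begin

lemma M_at_top: "filterlim M at_top sequentially"
  by (rule filterlim_proportional[OF M_lim \<gamma>_pos])

lemma m_at_top: "filterlim m at_top sequentially"
  by (rule filterlim_proportional[OF m_lim p_pos])

lemma term_ratio_lim: "(\<lambda>k. term_ratio (M k) (L k) (m k) s) \<longlonglongrightarrow> exp (- \<beta> * s)"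
proof -
  \<comment> \<open>Exact, not approximate: the base of the power \<open>term_ratio\<close> is
    \<open>1 + d k\<close> as soon as \<open>m\<close> exceeds \<open>|s|\<close>.\<close>
  define d where "d k = - s * real (L k) / ((real (m k) + s) * (real (m k) + real (L k)))" for k
  have "filterlim (\<lambda>k. real (m k)) at_top sequentially"
    using m_at_top filterlim_real_sequentially filterlim_compose by blast
  then have ev: "\<forall>\<^sub>F k in sequentially. real (m k) > \<bar>s\<bar>"
    by (simp add: filterlim_at_top_dense)
  have "(\<lambda>k. real (m k) / real (N k) / (real (m k) / real (N k) + s * inverse (real (N k)))) \<longlonglongrightarrow> p / (p + s * 0)"
    by (intro tendsto_intros m_lim inverse_N_lim) (use p_pos in auto)
  moreover have "real (m k) / real (N k) / (real (m k) / real (N k) + s * inverse (real (N k))) = real (m k) / (real (m k) + s)" for k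
    using N_pos[of k] by (simp add: inverse_eq_divide add_divide_distrib[symmetric])
  ultimately have "(\<lambda>k. real (m k) / (real (m k) + s)) \<longlonglongrightarrow> p / (p + s * 0)"
    by (simp only:)
  then have "(\<lambda>k. real (m k) / (real (m k) + s)) \<longlonglongrightarrow> 1"
    using p_pos by simp
  from tendsto_mult[OF tendsto_mult[OF tendsto_const rate_lim] this, of "- s"]
  have "(\<lambda>k. - s * (real (M k) * (real (L k) / (real (m k) * real (m k + L k)))) * (real (m k) / (real (m k) + s))) \<longlonglongrightarrow> - \<beta> * s"
    by (simp add: mult.commute)
  moreover have "- s * (real (M k) * (real (L k) / (real (m k) * real (m k + L k)))) * (real (m k) / (real (m k) + s)) = real (M k) * d k" for k
    using m_pos[of k] by (cases "real (m k) + s = 0") (simp_all add: d_def divide_simps)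
  ultimately have "(\<lambda>k. real (M k) * d k) \<longlonglongrightarrow> - \<beta> * s" by simp
  then have "(\<lambda>k. complex_of_real (real (M k) * d k)) \<longlonglongrightarrow> of_real (- \<beta> * s)"
    by (rule tendsto_of_real)
  then have "(\<lambda>k. (1 + complex_of_real (d k)) ^ M k) \<longlonglongrightarrow> exp (of_real (- \<beta> * s))"
    by (intro tendsto_one_plus_power_exp M_at_top) simp
  then have "(\<lambda>k. complex_of_real ((1 + d k) ^ M k)) \<longlonglongrightarrow> of_real (exp (- \<beta> * s))"
    by (simp only: exp_of_real of_real_power of_real_add of_real_1)
  then have "(\<lambda>k. (1 + d k) ^ M k) \<longlonglongrightarrow> exp (- \<beta> * s)"
    by (simp only: tendsto_of_real_iff)
  moreover have "\<forall>\<^sub>F k in sequentially. (1 + d k) ^ M k = term_ratio (M k) (L k) (m k) s"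
    using ev
  proof eventually_elim
    case (elim k)
    then have "real (m k) + s \<noteq> 0" "real (m k) + real (L k) \<noteq> 0" by auto
    then have "1 + d k = (real (m k) + real (L k) + s) / (real (m k) + s) * (real (m k) / (real (m k) + real (L k)))"
      by (simp add: d_def divide_simps) (simp add: algebra_simps)
    then show ?case by (simp add: term_ratio_def)
  qed
  ultimately show ?thesis by (rule Lim_transform_eventually)
qed

text \<open>Since \<open>N\<close> is asymptotically \<open>M / \<gamma>\<close>, the scale in the
  scaled points is asymptotically \<open>1 / M\<close>, which makes their \<open>M\<close>-th powers
  converge to exponentials.\<close>

lemma scaling_lim: "(\<lambda>k. real (M k) * (1 / sqrt (\<gamma> * real (M k) * real (N k)))) \<longlonglongrightarrow> 1"
proof -
  have "(\<lambda>k. sqrt (real (M k) / real (N k) / \<gamma>)) \<longlonglongrightarrow> sqrt (\<gamma> / \<gamma>)"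
    by (intro tendsto_intros M_lim) (use \<gamma>_pos in auto)
  moreover have "sqrt (real (M k) / real (N k) / \<gamma>) = real (M k) * (1 / sqrt (\<gamma> * real (M k) * real (N k)))" for k
  proof -
    have "real (M k) / real (N k) / \<gamma> = (real (M k))\<^sup>2 / (\<gamma> * real (M k) * real (N k))"
      using M_pos[of k] by (simp add: power2_eq_square)
    then show ?thesis by (simp add: real_sqrt_divide)
  qed
  ultimately show ?thesis using \<gamma>_pos by simp
qed

text \<open>The factor of the scaled point beside \<open>u ^ M\<close>. It carries all dependence on
  \<open>v\<close> and has a limit, whereas \<open>u ^ M\<close> decays exponentially with a phase
  that need not converge.\<close>

definition local_factor :: "nat \<Rightarrow> complex \<Rightarrow> complex" where
  "local_factor k v = (1 + of_real (1 / sqrt (\<gamma> * real (M k) * real (N k))) * (v - of_real (\<beta> / 4))) ^ M k"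

lemma local_factor_lim:
  assumes "v \<longlonglongrightarrow> a"
  shows "(\<lambda>k. local_factor k (v k)) \<longlonglongrightarrow> exp (a - of_real (\<beta> / 4))"
  unfolding local_factor_def
proof (rule tendsto_one_plus_power_exp[OF M_at_top])
  have "(\<lambda>k. of_real (real (M k) * (1 / sqrt (\<gamma> * real (M k) * real (N k)))) * (v k - of_real (\<beta> / 4)))
      \<longlonglongrightarrow> of_real 1 * (a - of_real (\<beta> / 4))"
    by (intro tendsto_mult tendsto_of_real scaling_lim tendsto_diff assms tendsto_const)
  then show "(\<lambda>k. of_nat (M k) * (of_real (1 / sqrt (\<gamma> * real (M k) * real (N k))) * (v k - of_real (\<beta> / 4))))
      \<longlonglongrightarrow> a - of_real (\<beta> / 4)"
    by (simp add: mult.assoc)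
qed

lemma local_factor_nonzero:
  assumes "v \<longlonglongrightarrow> a"
  shows "\<forall>\<^sub>F k in sequentially. local_factor k (v k) \<noteq> 0"
  using local_factor_lim[OF assms] by (rule tendsto_imp_eventually_ne) simp

text \<open>The shift in \<open>local_factor\<close> contributes \<open>- \<beta> / 2\<close> to
  twice the logarithm and cancels the constant of \<open>mean_lim\<close>.\<close>

lemma log_modulus_lim:
  fixes u v :: "nat \<Rightarrow> complex"
  assumes u: "\<And>k. (cmod (u k))\<^sup>2 = real (m k) / (real (m k) + real (L k))" and v: "v \<longlonglongrightarrow> a"
  shows "(\<lambda>k. real (M k) * (\<Sum>l<L k. 1 / real (m k + l)) + 2 * ln (cmod (u k ^ M k * local_factor k (v k)))) \<longlonglongrightarrow> 2 * Re a"
proof -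
  have "(\<lambda>k. ln (cmod (local_factor k (v k)))) \<longlonglongrightarrow> ln (cmod (exp (a - of_real (\<beta> / 4))))"
    by (intro tendsto_ln tendsto_norm local_factor_lim v) simp
  then have "(\<lambda>k. ln (cmod (local_factor k (v k)))) \<longlonglongrightarrow> Re a - \<beta> / 4" by simp
  from tendsto_add[OF mean_lim tendsto_mult[OF tendsto_const this, of 2]]
  have "(\<lambda>k. (real (M k) * (\<Sum>l<L k. 1 / real (m k + l)) - real (M k) * ln (real (m k + L k) / real (m k)))
      + 2 * ln (cmod (local_factor k (v k)))) \<longlonglongrightarrow> 2 * Re a"
    by simp
  moreover have "\<forall>\<^sub>F k in sequentially. (real (M k) * (\<Sum>l<L k. 1 / real (m k + l)) - real (M k) * ln (real (m k + L k) / real (m k)))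
      + 2 * ln (cmod (local_factor k (v k))) =
      real (M k) * (\<Sum>l<L k. 1 / real (m k + l)) + 2 * ln (cmod (u k ^ M k * local_factor k (v k)))"
    using local_factor_nonzero[OF v]
  proof eventually_elim
    case (elim k)
    have u0: "cmod (u k) > 0"
    proof -
      have "(cmod (u k))\<^sup>2 > 0" using u[of k] m_pos[of k] by (simp add: add_pos_nonneg)
      then show ?thesis by simp
    qed
    have "2 * ln (cmod (u k)) = ln ((cmod (u k))\<^sup>2)"
      using u0 by (simp add: ln_realpow)
    also have "\<dots> = - ln (real (m k + L k) / real (m k))"
      unfolding u using m_pos[of k] by (simp add: ln_div)
    finally have "2 * ln (cmod (u k)) = - ln (real (m k + L k) / real (m k))" .
    moreover have "ln (cmod (u k ^ M k * local_factor k (v k))) = real (M k) * ln (cmod (u k)) + ln (cmod (local_factor k (v k)))"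
      using elim u0 by (simp add: norm_mult norm_power ln_mult ln_realpow)
    ultimately show ?case by (simp add: algebra_simps)
  qed
  ultimately show ?thesis by (rule Lim_transform_eventually)
qed

text \<open>The terms of index \<open>m - 1\<close> up to \<open>N - 1\<close> divided by the peak
  term; \<open>down_sum\<close> takes those of index \<open>m - 1\<close> down to \<open>0\<close>.
  The peak is the summand \<open>1\<close> of both.\<close>

definition up_sum :: "nat \<Rightarrow> complex \<Rightarrow> complex" where
  "up_sum k \<zeta> = (\<Sum>i<Suc (N k - m k). (\<Prod>l<i. of_real (term_ratio (M k) (L k) (m k) (real l))) * \<zeta> ^ i)"

definition down_sum :: "nat \<Rightarrow> complex \<Rightarrow> complex" where
  "down_sum k \<zeta> = (\<Sum>i<m k. (\<Prod>l<i. of_real (inverse (term_ratio (M k) (L k) (m k) (- real (Suc l))))) * inverse \<zeta> ^ i)"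

text \<open>Here \<open>\<delta> = 0\<close>, and the linear constant \<open>\<beta> / 2\<close>
  produced by the quotients is removed by the \<open>- \<beta> / 2\<close> in the limit of
  \<open>\<zeta>\<close>.\<close>

lemma up_sum_lim:
  assumes "filterlim (\<lambda>k. N k - m k) at_top sequentially"
    and \<zeta>: "\<zeta> \<longlonglongrightarrow> exp (s - of_real (\<beta> / 2))"
  shows "summable (\<lambda>j. norm (exp (- 1 / 2 * of_real \<beta> * of_nat j ^ 2 + s * of_nat j)))"
    "(\<lambda>k. up_sum k (\<zeta> k)) \<longlonglongrightarrow> (\<Sum>j. exp (- 1 / 2 * of_real \<beta> * of_nat j ^ 2 + s * of_nat j))"
proof -
  have K: "filterlim (\<lambda>k. Suc (N k - m k)) at_top sequentially"
    using assms(1) filterlim_Suc filterlim_compose by blast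
  have \<rho>: "(\<lambda>k. term_ratio (M k) (L k) (m k) (real l)) \<longlonglongrightarrow> exp (- \<beta> * (real l + 0))" for l
    using term_ratio_lim[of "real l"] by simp
  note * = tendsto_sum_quadratic_exponential[where \<rho> = "\<lambda>l k. term_ratio (M k) (L k) (m k) (real l)",
    OF \<beta>_pos K term_ratio_up_props(1)[OF m_pos order.refl] term_ratio_up_props(2)[OF m_pos] \<rho> \<zeta>]
  have eq: "- of_real (\<beta> / 2) * of_nat k ^ 2 + of_nat k * (s - of_real (\<beta> / 2) + of_real (\<beta> / 2 - \<beta> * 0))
      = - 1 / 2 * of_real \<beta> * of_nat k ^ 2 + s * of_nat k" for k :: nat
    by (simp add: mult.commute)
  show "summable (\<lambda>j. norm (exp (- 1 / 2 * of_real \<beta> * of_nat j ^ 2 + s * of_nat j)))"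
    by (rule *(1)[unfolded eq])
  show "(\<lambda>k. up_sum k (\<zeta> k)) \<longlonglongrightarrow> (\<Sum>j. exp (- 1 / 2 * of_real \<beta> * of_nat j ^ 2 + s * of_nat j))"
    unfolding up_sum_def by (rule *(2)[unfolded eq])
qed

text \<open>Here \<open>\<delta> = 1\<close>, and inverting \<open>\<zeta>\<close> adds another
  \<open>\<beta> / 2\<close>. The linear constants
  \<open>\<beta> / 2 + \<beta> / 2 - \<beta>\<close> cancel, so this half mirrors the upper one with
  \<open>- s\<close> for \<open>s\<close>.\<close>

lemma down_sum_lim:
  assumes \<zeta>: "\<zeta> \<longlonglongrightarrow> exp (s - of_real (\<beta> / 2))"
  shows "summable (\<lambda>j. norm (exp (- 1 / 2 * of_real \<beta> * of_nat j ^ 2 - s * of_nat j)))"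
    "(\<lambda>k. down_sum k (\<zeta> k)) \<longlonglongrightarrow> (\<Sum>j. exp (- 1 / 2 * of_real \<beta> * of_nat j ^ 2 - s * of_nat j))"
proof -
  have "(\<lambda>k. inverse (\<zeta> k)) \<longlonglongrightarrow> inverse (exp (s - of_real (\<beta> / 2)))"
    using \<zeta> by (rule tendsto_inverse) simp
  then have \<zeta>': "(\<lambda>k. inverse (\<zeta> k)) \<longlonglongrightarrow> exp (- (s - of_real (\<beta> / 2)))"
    by (simp only: exp_minus)
  have "(\<lambda>k. inverse (term_ratio (M k) (L k) (m k) (- real (Suc l)))) \<longlonglongrightarrow> inverse (exp (- \<beta> * - real (Suc l)))" for l
    by (intro tendsto_inverse term_ratio_lim) simp
  moreover have "inverse (exp (- \<beta> * - real (Suc l))) = exp (- \<beta> * (real l + 1))" for l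
    by (simp add: exp_minus[symmetric] algebra_simps)
  ultimately have \<rho>: "(\<lambda>k. inverse (term_ratio (M k) (L k) (m k) (- real (Suc l)))) \<longlonglongrightarrow> exp (- \<beta> * (real l + 1))" for l
    by simp
  note * = tendsto_sum_quadratic_exponential[where \<rho> = "\<lambda>l k. inverse (term_ratio (M k) (L k) (m k) (- real (Suc l)))",
    OF \<beta>_pos m_at_top term_ratio_down_props(1)[OF order.refl] term_ratio_down_props(2) \<rho> \<zeta>']
  have eq: "- of_real (\<beta> / 2) * of_nat k ^ 2 + of_nat k * (- (s - of_real (\<beta> / 2)) + of_real (\<beta> / 2 - \<beta> * 1))
      = - 1 / 2 * of_real \<beta> * of_nat k ^ 2 - s * of_nat k" for k :: nat
    by (simp add: algebra_simps)
  show "summable (\<lambda>j. norm (exp (- 1 / 2 * of_real \<beta> * of_nat j ^ 2 - s * of_nat j)))"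
    by (rule *(1)[unfolded eq])
  show "(\<lambda>k. down_sum k (\<zeta> k)) \<longlonglongrightarrow> (\<Sum>j. exp (- 1 / 2 * of_real \<beta> * of_nat j ^ 2 - s * of_nat j))"
    unfolding down_sum_def by (rule *(2)[unfolded eq])
qed

end

subsection \<open>The limit of the correlation functions\<close>

context critical_regime
begin

text \<open>The kernel multiplied by \<open>\<bar>z\<bar> \<bar>z'\<bar>\<close>, without the factor \<open>sgn z ^ (m - 1) * cnj (sgn z' ^ (m - 1))\<close>,
  which oscillates but cancels in determinants.\<close>

definition reduced_kernel :: "real \<Rightarrow> nat \<Rightarrow> (nat \<Rightarrow> complex) \<Rightarrow> complex \<Rightarrow> complex \<Rightarrow> complex" where
  "reduced_kernel c k u v w = 1 / of_real pi *
    csqrt (weight c (M k) (L k) (u k ^ M k * local_factor k v)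
        * of_real ((\<Prod>l<L k. real (m k + l)) ^ M k * cmod (u k ^ M k * local_factor k v) ^ (2 * m k))
      * (weight c (M k) (L k) (u k ^ M k * local_factor k w)
        * of_real ((\<Prod>l<L k. real (m k + l)) ^ M k * cmod (u k ^ M k * local_factor k w) ^ (2 * m k)))) *
    (up_sum k (local_factor k v * cnj (local_factor k w)) + down_sum k (local_factor k v * cnj (local_factor k w)) - 1)"

lemma kernel_sum_eq:
  fixes x \<zeta> :: complex
  assumes x: "x = \<zeta> * of_real ((real (m k) / (real (m k) + real (L k))) ^ M k)" and x0: "x \<noteq> 0"
    and mN: "m k \<le> N k"
  shows "(\<Sum>j<N k. Gamma (of_nat (L k + j + 1)) ^ M k / Gamma (of_nat (j + 1)) ^ M k * x ^ j) =
    of_real ((\<Prod>l<L k. real (m k + l)) ^ M k) * x ^ (m k - 1) * (up_sum k \<zeta> + down_sum k \<zeta> - 1)"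
proof -
  define F where "F j = of_real (gamma_ratio (M k) (L k) j) * x ^ j" for j
  define A where "A = F (m k - 1)"
  have "(\<Sum>j<N k. F j) = (\<Sum>i<N k - (m k - 1). F (m k - 1 + i)) + (\<Sum>i<Suc (m k - 1). F (m k - 1 - i)) - A"
    unfolding A_def by (rule sum_lessThan_split_both_directions) (use mN m_pos[of k] in linarith)
  moreover have "(\<Sum>i<N k - (m k - 1). F (m k - 1 + i)) = A * up_sum k \<zeta>"
  proof -
    have "N k - (m k - 1) = Suc (N k - m k)"
      using mN m_pos[of k] by linarith
    then show ?thesis
      unfolding F_def A_def up_sum_def sum_distrib_left
      by (intro sum.cong gamma_ratio_up m_pos x) simp
  qed
  moreover have "(\<Sum>i<Suc (m k - 1). F (m k - 1 - i)) = A * down_sum k \<zeta>"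
  proof -
    have "Suc (m k - 1) = m k"
      using m_pos[of k] by linarith
    then show ?thesis
      unfolding F_def A_def down_sum_def sum_distrib_left
      by (intro sum.cong gamma_ratio_down m_pos x x0) auto
  qed
  ultimately have "(\<Sum>j<N k. F j) = A * (up_sum k \<zeta> + down_sum k \<zeta> - 1)"
    by (simp only: ring_distribs mult_1_right)
  moreover have "A = of_real ((\<Prod>l<L k. real (m k + l)) ^ M k) * x ^ (m k - 1)"
    using m_pos[of k] by (simp add: A_def F_def gamma_ratio_eq_prod)
  ultimately show ?thesis
    by (simp only: F_def gamma_ratio_eq_Gamma)
qed

text \<open>The normalisations of the two weights leave the square root as
  \<open>C * cmod z ^ m * cmod z' ^ m\<close>. Here \<open>C\<close> is the peak coefficient,
  \<open>m - 1\<close> of the factors \<open>cmod z\<close> are the modulus of the peak power and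
  the last one stands in front of the kernel; likewise for \<open>z'\<close>. Only phases
  remain.\<close>

lemma eigenvalue_kernel_eq_reduced:
  fixes u :: "nat \<Rightarrow> complex"
  assumes u: "(cmod (u k))\<^sup>2 = real (m k) / (real (m k) + real (L k))"
    and v: "local_factor k v \<noteq> 0" and w: "local_factor k w \<noteq> 0" and mN: "m k \<le> N k"
    and z: "z = u k ^ M k * local_factor k v" and z': "z' = u k ^ M k * local_factor k w"
  shows "of_real (cmod z) * of_real (cmod z') * eigenvalue_kernel c (M k) (N k) (L k) z z' =
    sgn z ^ (m k - 1) * cnj (sgn z' ^ (m k - 1)) * reduced_kernel c k u v w"
proof -
  define C where "C = (\<Prod>l<L k. real (m k + l)) ^ M k"
  define W where "W = csqrt (weight c (M k) (L k) z * weight c (M k) (L k) z')"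
  define \<zeta> where "\<zeta> = local_factor k v * cnj (local_factor k w)"
  define S where "S = up_sum k \<zeta> + down_sum k \<zeta> - 1"
  have C: "C \<ge> 0" by (simp add: C_def prod_nonneg)
  have u0: "u k \<noteq> 0"
    using u m_pos[of k] by auto
  have z0: "z \<noteq> 0" "z' \<noteq> 0"
    using u0 v w by (auto simp: z z')
  have "u k ^ M k * cnj (u k) ^ M k = of_real ((real (m k) / (real (m k) + real (L k))) ^ M k)"
    by (simp only: power_mult_distrib[symmetric] complex_norm_square[symmetric] u of_real_power)
  then have x: "z * cnj z' = \<zeta> * of_real ((real (m k) / (real (m k) + real (L k))) ^ M k)"
    by (simp add: z z' \<zeta>_def mult_ac)
  have sum: "(\<Sum>j<N k. Gamma (of_nat (L k + j + 1)) ^ M k / Gamma (of_nat (j + 1)) ^ M k * (z * cnj z') ^ j) =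
      of_real C * (z * cnj z') ^ (m k - 1) * S"
    unfolding S_def C_def by (rule kernel_sum_eq[OF x _ mN]) (use z0 in simp)
  have sgn: "z = of_real (cmod z) * sgn z" "z' = of_real (cmod z') * sgn z'"
    using z0 by (auto simp: sgn_div_norm scaleR_conv_of_real)
  have pow: "(z * cnj z') ^ (m k - 1) = of_real (cmod z ^ (m k - 1)) * of_real (cmod z' ^ (m k - 1)) *
      (sgn z ^ (m k - 1) * cnj (sgn z' ^ (m k - 1)))"
  proof -
    have "z * cnj z' = (of_real (cmod z) * sgn z) * cnj (of_real (cmod z') * sgn z')"
      by (simp only: sgn[symmetric])
    then show ?thesis
      by (simp only: complex_cnj_mult complex_cnj_complex_of_real power_mult_distrib complex_cnj_power of_real_power mult_ac)
  qed
  have "weight c (M k) (L k) z * of_real (C * cmod z ^ (2 * m k)) * (weight c (M k) (L k) z' * of_real (C * cmod z' ^ (2 * m k)))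
      = of_real ((C * cmod z ^ m k * cmod z' ^ m k)\<^sup>2) * (weight c (M k) (L k) z * weight c (M k) (L k) z')"
    unfolding power_even_eq
    by (simp only: power_mult_distrib of_real_mult of_real_power power2_eq_square mult_ac)
  then have red: "reduced_kernel c k u v w = 1 / of_real pi * (of_real (C * cmod z ^ m k * cmod z' ^ m k) * W) * S"
    unfolding reduced_kernel_def z[symmetric] z'[symmetric] C_def[symmetric] \<zeta>_def[symmetric] S_def[symmetric] W_def
    using C by (simp only: csqrt_of_real_power2_mult mult_nonneg_nonneg zero_le_power norm_ge_zero)
  have m1: "cmod z ^ m k = cmod z * cmod z ^ (m k - 1)" "cmod z' ^ m k = cmod z' * cmod z' ^ (m k - 1)"
    using m_pos[of k] by (simp_all flip: power_Suc)
  show ?thesis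
    unfolding eigenvalue_kernel_def sum red pow m1 W_def[symmetric] by (simp add: mult_ac)
qed

text \<open>By \<open>log_modulus_lim\<close> the Gaussian densities are evaluated at
  \<open>2 * Re a\<close> and \<open>2 * Re b\<close>; the square root forms their geometric mean.
  It passes to the limit because their product is positive, off the branch cut of
  \<open>csqrt\<close>.\<close>

lemma reduced_kernel_lim:
  assumes c: "c > 0" and u: "\<And>k. (cmod (u k))\<^sup>2 = real (m k) / (real (m k) + real (L k))"
    and v: "v \<longlonglongrightarrow> a" and w: "w \<longlonglongrightarrow> b"
    and S: "(\<lambda>k. up_sum k (local_factor k (v k) * cnj (local_factor k (w k)))
      + down_sum k (local_factor k (v k) * cnj (local_factor k (w k))) - 1) \<longlonglongrightarrow> S"
  shows "(\<lambda>k. reduced_kernel c k u (v k) (w k)) \<longlonglongrightarrow>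
    of_real (exp (- ((Re a)\<^sup>2 + (Re b)\<^sup>2) / \<beta>) / sqrt (2 * pi ^ 3 * \<beta>)) * S"
proof -
  let ?W = "\<lambda>v k. weight c (M k) (L k) (u k ^ M k * local_factor k (v k))
        * of_real ((\<Prod>l<L k. real (m k + l)) ^ M k * cmod (u k ^ M k * local_factor k (v k)) ^ (2 * m k))"
  define r where "r x = exp (- (2 * x)\<^sup>2 / (2 * \<beta>)) / sqrt (2 * pi * \<beta>)" for x
  have u0: "u k \<noteq> 0" for k
    using u[of k] m_pos[of k] by auto
  have W: "?W v \<longlonglongrightarrow> of_real (r (Re a))" if "v \<longlonglongrightarrow> a" for v a
    unfolding r_def using local_factor_nonzero[OF that] u0
    by (intro weight_lim[OF c _ log_modulus_lim[OF u that]]) (auto elim: eventually_mono)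
  have r: "r x > 0" for x using \<beta>_pos by (simp add: r_def)
  have "(\<lambda>k. csqrt (?W v k * ?W w k)) \<longlonglongrightarrow> csqrt (of_real (r (Re a)) * of_real (r (Re b)))"
  proof (rule isCont_tendsto_compose[OF _ tendsto_mult[OF W[OF v] W[OF w]]])
    have "complex_of_real (r (Re a)) * of_real (r (Re b)) \<notin> \<real>\<^sub>\<le>\<^sub>0"
      using r by (simp flip: of_real_mult) (simp add: not_le)
    then show "isCont csqrt (complex_of_real (r (Re a)) * of_real (r (Re b)))"
      by (rule continuous_at_csqrt)
  qed
  then have "(\<lambda>k. 1 / of_real pi * csqrt (?W v k * ?W w k) * (up_sum k (local_factor k (v k) * cnj (local_factor k (w k)))
      + down_sum k (local_factor k (v k) * cnj (local_factor k (w k))) - 1)) \<longlonglongrightarrow>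
      1 / of_real pi * csqrt (of_real (r (Re a)) * of_real (r (Re b))) * S"
    by (intro tendsto_mult tendsto_const S)
  moreover have "1 / of_real pi * csqrt (of_real (r (Re a)) * of_real (r (Re b)))
      = of_real (exp (- ((Re a)\<^sup>2 + (Re b)\<^sup>2) / \<beta>) / sqrt (2 * pi ^ 3 * \<beta>))"
  proof -
    have "r (Re a) * r (Re b) = (exp (- ((Re a)\<^sup>2 + (Re b)\<^sup>2) / \<beta>) / sqrt (2 * pi * \<beta>))\<^sup>2"
    proof -
      have "exp (- (2 * Re a)\<^sup>2 / (2 * \<beta>)) * exp (- (2 * Re b)\<^sup>2 / (2 * \<beta>)) = (exp (- ((Re a)\<^sup>2 + (Re b)\<^sup>2) / \<beta>))\<^sup>2"
        unfolding exp_double[symmetric] mult_exp_exp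
        by (rule arg_cong[of _ _ exp]) (use \<beta>_pos in \<open>simp add: field_simps power2_eq_square\<close>)
      then show ?thesis
        by (simp add: r_def power_divide power2_eq_square)
    qed
    then have "csqrt (of_real (r (Re a)) * of_real (r (Re b))) = of_real (exp (- ((Re a)\<^sup>2 + (Re b)\<^sup>2) / \<beta>) / sqrt (2 * pi * \<beta>))"
      using \<beta>_pos by (simp only: of_real_mult[symmetric]) (subst csqrt_of_real, auto)
    moreover have "sqrt (2 * pi ^ 3 * \<beta>) = pi * sqrt (2 * pi * \<beta>)"
      by (rule real_sqrt_unique) (use \<beta>_pos in \<open>auto simp: power_mult_distrib power2_eq_square power3_eq_cube\<close>)
    ultimately show ?thesis by simp
  qed
  ultimately show ?thesis
    unfolding reduced_kernel_def by (simp only:)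
qed

text \<open>The critical kernels contain an oscillating factor of the same kind.\<close>

definition gauge :: "complex \<Rightarrow> complex" where
  "gauge v = cis (- Re v * Im v / \<beta>)"

lemma norm_gauge: "cmod (gauge v) = 1"
  by (simp add: gauge_def)

text \<open>\<open>|z|^2 + z^2 = 2 (Re z)^2 + 2 \<i> Re z Im z\<close>: the real part gives the
  Gaussian and the imaginary part the phase, conjugated for \<open>z2\<close>.\<close>

lemma gauge_prefactor:
  "of_real (1 / sqrt (2 * pi ^ 3 * \<beta>)) *
     exp (- 1 / (2 * of_real \<beta>) *
       (of_real ((cmod z1)\<^sup>2) + of_real ((cmod (cnj z2))\<^sup>2) + z1\<^sup>2 + (cnj z2)\<^sup>2)) =
   gauge z1 * cnj (gauge z2) * of_real (exp (- ((Re z1)\<^sup>2 + (Re z2)\<^sup>2) / \<beta>) / sqrt (2 * pi ^ 3 * \<beta>))"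
proof -
  have "- 1 / (2 * of_real \<beta>) * (of_real ((cmod z1)\<^sup>2) + of_real ((cmod (cnj z2))\<^sup>2) + z1\<^sup>2 + (cnj z2)\<^sup>2)
      = \<i> * of_real (- Re z1 * Im z1 / \<beta>) + cnj (\<i> * of_real (- Re z2 * Im z2 / \<beta>)) + of_real (- ((Re z1)\<^sup>2 + (Re z2)\<^sup>2) / \<beta>)"
  proof -
    have "of_real ((cmod z1)\<^sup>2) + of_real ((cmod (cnj z2))\<^sup>2) + z1\<^sup>2 + (cnj z2)\<^sup>2
        = 2 * (\<i> * of_real (Re z1 * Im z1) - \<i> * of_real (Re z2 * Im z2) + of_real ((Re z1)\<^sup>2 + (Re z2)\<^sup>2))"
      by (simp add: complex_eq_iff cmod_power2) (simp add: power2_eq_square)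
    then have "- 1 / (2 * of_real \<beta>) * (of_real ((cmod z1)\<^sup>2) + of_real ((cmod (cnj z2))\<^sup>2) + z1\<^sup>2 + (cnj z2)\<^sup>2)
        = - ((\<i> * of_real (Re z1 * Im z1) - \<i> * of_real (Re z2 * Im z2) + of_real ((Re z1)\<^sup>2 + (Re z2)\<^sup>2)) / of_real \<beta>)"
    proof -
      have "- 1 / (2 * of_real \<beta>) * x = - (y / of_real \<beta>)" if "x = 2 * y" for x y :: complex
        using that by simp
      then show ?thesis using \<open>_ = 2 * _\<close> by blast
    qed
    also have "\<dots> = \<i> * of_real (- Re z1 * Im z1 / \<beta>) + cnj (\<i> * of_real (- Re z2 * Im z2 / \<beta>)) + of_real (- ((Re z1)\<^sup>2 + (Re z2)\<^sup>2) / \<beta>)"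
      by (simp add: complex_eq_iff add_divide_distrib diff_divide_distrib)
    finally show ?thesis .
  qed
  then have "exp (- 1 / (2 * of_real \<beta>) *
       (of_real ((cmod z1)\<^sup>2) + of_real ((cmod (cnj z2))\<^sup>2) + z1\<^sup>2 + (cnj z2)\<^sup>2)) =
      gauge z1 * cnj (gauge z2) * of_real (exp (- ((Re z1)\<^sup>2 + (Re z2)\<^sup>2) / \<beta>))"
    by (simp only: exp_add exp_of_real exp_cnj gauge_def cis_conv_exp)
  then show ?thesis by simp
qed

lemma bulk_limit:
  assumes NM: "filterlim (\<lambda>k. N k - m k) at_top sequentially"
    and c: "c > 0" and u: "\<And>k. (cmod (u k))\<^sup>2 = real (m k) / (real (m k) + real (L k))"
    and v: "v \<longlonglongrightarrow> a" and w: "w \<longlonglongrightarrow> b"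
  shows "\<exists>e. (\<lambda>k. reduced_kernel c k u (v k) (w k)) \<longlonglongrightarrow> e \<and> K_bulk_crit \<beta> a b = gauge a * cnj (gauge b) * e"
proof -
  have "(\<lambda>k. local_factor k (v k) * cnj (local_factor k (w k))) \<longlonglongrightarrow> exp (a - of_real (\<beta> / 4)) * cnj (exp (b - of_real (\<beta> / 4)))"
    by (intro tendsto_intros local_factor_lim v w)
  moreover have "exp (a - of_real (\<beta> / 4)) * cnj (exp (b - of_real (\<beta> / 4))) = exp (a + cnj b - of_real (\<beta> / 2))"
    unfolding exp_cnj mult_exp_exp by (rule arg_cong[of _ _ exp]) simp
  ultimately have \<zeta>: "(\<lambda>k. local_factor k (v k) * cnj (local_factor k (w k))) \<longlonglongrightarrow> exp (a + cnj b - of_real (\<beta> / 2))"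
    by simp
  \<comment> \<open>The critical kernel contains \<open>exp (- (a + cnj b) * j)\<close>, so the
    terms above the peak correspond to negative \<open>j\<close>.\<close>
  define g where "g j = exp (- 1 / 2 * of_real \<beta> * of_int j ^ 2 - (a + cnj b) * of_int j)" for j :: int
  have up: "summable (\<lambda>k. norm (g (- int k)))"
    "(\<lambda>k. up_sum k (local_factor k (v k) * cnj (local_factor k (w k)))) \<longlonglongrightarrow> (\<Sum>k. g (- int k))"
    using up_sum_lim[OF NM \<zeta>] by (simp_all add: g_def)
  have down: "summable (\<lambda>k. norm (g (int k)))"
    "(\<lambda>k. down_sum k (local_factor k (v k) * cnj (local_factor k (w k)))) \<longlonglongrightarrow> (\<Sum>k. g (int k))"
    using down_sum_lim[OF \<zeta>] by (simp_all add: g_def)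
  have "(\<lambda>k. up_sum k (local_factor k (v k) * cnj (local_factor k (w k)))
      + down_sum k (local_factor k (v k) * cnj (local_factor k (w k))) - 1) \<longlonglongrightarrow> (\<Sum>k. g (- int k)) + (\<Sum>k. g (int k)) - 1"
    by (intro tendsto_intros up down)
  moreover have "(\<Sum>k. g (- int k)) + (\<Sum>k. g (int k)) - 1 = (\<Sum>\<^sub>\<infinity>j\<in>UNIV. g j)"
    by (subst infsum_int_eq_suminf[OF down(1) up(1)]) (simp add: g_def)
  ultimately have "(\<lambda>k. reduced_kernel c k u (v k) (w k)) \<longlonglongrightarrow>
      of_real (exp (- ((Re a)\<^sup>2 + (Re b)\<^sup>2) / \<beta>) / sqrt (2 * pi ^ 3 * \<beta>)) * (\<Sum>\<^sub>\<infinity>j\<in>UNIV. g j)"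
    by (intro reduced_kernel_lim[OF c u v w]) simp
  moreover have "K_bulk_crit \<beta> a b = gauge a * cnj (gauge b) *
      (of_real (exp (- ((Re a)\<^sup>2 + (Re b)\<^sup>2) / \<beta>) / sqrt (2 * pi ^ 3 * \<beta>)) * (\<Sum>\<^sub>\<infinity>j\<in>UNIV. g j))"
    unfolding K_bulk_crit_def gauge_prefactor g_def by (simp only: mult.assoc)
  ultimately show ?thesis by blast
qed

lemma edge_limit:
  assumes NM: "\<And>k. m k = N k"
    and c: "c > 0" and u: "\<And>k. (cmod (u k))\<^sup>2 = real (m k) / (real (m k) + real (L k))"
    and v: "v \<longlonglongrightarrow> a" and w: "w \<longlonglongrightarrow> b"
  shows "\<exists>e. (\<lambda>k. reduced_kernel c k u (v k) (w k)) \<longlonglongrightarrow> e \<and> K_edge_crit \<beta> a b = gauge a * cnj (gauge b) * e"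
proof -
  have "(\<lambda>k. local_factor k (v k) * cnj (local_factor k (w k))) \<longlonglongrightarrow> exp (a - of_real (\<beta> / 4)) * cnj (exp (b - of_real (\<beta> / 4)))"
    by (intro tendsto_intros local_factor_lim v w)
  moreover have "exp (a - of_real (\<beta> / 4)) * cnj (exp (b - of_real (\<beta> / 4))) = exp (a + cnj b - of_real (\<beta> / 2))"
    unfolding exp_cnj mult_exp_exp by (rule arg_cong[of _ _ exp]) simp
  ultimately have \<zeta>: "(\<lambda>k. local_factor k (v k) * cnj (local_factor k (w k))) \<longlonglongrightarrow> exp (a + cnj b - of_real (\<beta> / 2))"
    by simp
  \<comment> \<open>With \<open>m = N\<close> nothing lies above the peak; the remaining
    \<open>1\<close> is the peak itself and cancels the \<open>- 1\<close>.\<close>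
  have "up_sum k x = 1" for k x
    by (simp add: up_sum_def NM)
  then have "(\<lambda>k. up_sum k (local_factor k (v k) * cnj (local_factor k (w k)))
      + down_sum k (local_factor k (v k) * cnj (local_factor k (w k))) - 1) \<longlonglongrightarrow>
      (\<Sum>j. exp (- 1 / 2 * of_real \<beta> * of_nat j ^ 2 - (a + cnj b) * of_nat j))"
    using down_sum_lim(2)[OF \<zeta>] by simp
  note reduced_kernel_lim[OF c u v w this]
  moreover have "K_edge_crit \<beta> a b = gauge a * cnj (gauge b) *
      (of_real (exp (- ((Re a)\<^sup>2 + (Re b)\<^sup>2) / \<beta>) / sqrt (2 * pi ^ 3 * \<beta>)) *
        (\<Sum>j. exp (- 1 / 2 * of_real \<beta> * of_nat j ^ 2 - (a + cnj b) * of_nat j)))"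
    unfolding K_edge_crit_def gauge_prefactor by (simp only: mult.assoc)
  ultimately show ?thesis by blast
qed

text \<open>Unimodular factors are removed twice: powers of \<open>sgn z\<close> at finite
  \<open>k\<close> and gauges in the limit. In between, the reduced kernels converge
  entrywise.\<close>

lemma correlation_limit:
  fixes R :: "nat \<Rightarrow> complex ^ 'n \<Rightarrow> real" and v :: "nat \<Rightarrow> complex ^ 'n" and Kc :: "complex \<Rightarrow> complex \<Rightarrow> complex"
  assumes u: "\<And>k. (cmod (u k))\<^sup>2 = real (m k) / (real (m k) + real (L k))"
    and mN: "\<And>k. m k \<le> N k"
    and R: "\<And>k z. complex_of_real (R k z) =
      Determinants.det (\<chi> i j. eigenvalue_kernel c (M k) (N k) (L k) (z $ i) (z $ j))"
    and kernel_lim: "\<And>v w a b. v \<longlonglongrightarrow> a \<Longrightarrow> w \<longlonglongrightarrow> b \<Longrightarrow>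
      \<exists>e. (\<lambda>k. reduced_kernel c k u (v k) (w k)) \<longlonglongrightarrow> e \<and> Kc a b = gauge a * cnj (gauge b) * e"
    and v: "v \<longlonglongrightarrow> a"
  shows "(\<lambda>k. let z = (\<chi> i. u k ^ M k * local_factor k (v k $ i))
      in complex_of_real ((cmod (\<Prod>i\<in>UNIV. z $ i))\<^sup>2 * R k z))
    \<longlonglongrightarrow> Determinants.det (\<chi> i j. Kc (a $ i) (a $ j))"
proof -
  have vi: "(\<lambda>k. v k $ i) \<longlonglongrightarrow> a $ i" for i
    by (rule tendsto_vec_nth[OF v])
  define e where "e i j = lim (\<lambda>k. reduced_kernel c k u (v k $ i) (v k $ j))" for i j
  have e: "(\<lambda>k. reduced_kernel c k u (v k $ i) (v k $ j)) \<longlonglongrightarrow> e i j"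
    "Kc (a $ i) (a $ j) = gauge (a $ i) * cnj (gauge (a $ j)) * e i j" for i j
    using kernel_lim[OF vi[of i] vi[of j]] by (auto simp: e_def limI)
  have 1: "(\<lambda>k. Determinants.det (\<chi> i j. reduced_kernel c k u (v k $ i) (v k $ j))) \<longlonglongrightarrow> Determinants.det (\<chi> i j. e i j)"
    by (rule tendsto_det) (rule e(1))
  have 2: "Determinants.det (\<chi> i j. e i j) = Determinants.det (\<chi> i j. Kc (a $ i) (a $ j))"
    unfolding e(2) by (rule det_unimodular_scale[symmetric]) (rule norm_gauge)
  have 3: "\<forall>\<^sub>F k in sequentially. Determinants.det (\<chi> i j. reduced_kernel c k u (v k $ i) (v k $ j)) =
      (let z = (\<chi> i. u k ^ M k * local_factor k (v k $ i))
      in complex_of_real ((cmod (\<Prod>i\<in>UNIV. z $ i))\<^sup>2 * R k z))"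
  proof -
    \<comment> \<open>A scaled point may vanish for small \<open>k\<close>; the finitely many
      coordinates are nonzero together from some index on.\<close>
    have "\<forall>\<^sub>F k in sequentially. \<forall>i. local_factor k (v k $ i) \<noteq> 0"
      by (rule eventually_all_finite) (rule local_factor_nonzero[OF vi])
    then show ?thesis
    proof eventually_elim
      case (elim k)
      define z where "z i = u k ^ M k * local_factor k (v k $ i)" for i
      have "u k \<noteq> 0"
        using u[of k] m_pos[of k] by auto
      with elim have z0: "z i \<noteq> 0" for i by (simp add: z_def)
      have "complex_of_real ((cmod (\<Prod>i\<in>UNIV. z i))\<^sup>2 * R k (\<chi> i. z i)) =
          (\<Prod>i\<in>UNIV. of_real (cmod (z i))) * (\<Prod>i\<in>UNIV. of_real (cmod (z i))) *
            Determinants.det (\<chi> i j. eigenvalue_kernel c (M k) (N k) (L k) (z i) (z j))"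
        by (simp add: R power2_eq_square prod_norm[symmetric])
      also have "\<dots> = Determinants.det (\<chi> i j. of_real (cmod (z i)) * of_real (cmod (z j)) *
          eigenvalue_kernel c (M k) (N k) (L k) (z i) (z j))"
        by (rule det_diagonal_scale[symmetric])
      also have "\<dots> = Determinants.det (\<chi> i j. sgn (z i) ^ (m k - 1) * cnj (sgn (z j) ^ (m k - 1)) *
          reduced_kernel c k u (v k $ i) (v k $ j))"
      proof -
        have "of_real (cmod (z i)) * of_real (cmod (z j)) * eigenvalue_kernel c (M k) (N k) (L k) (z i) (z j) =
            sgn (z i) ^ (m k - 1) * cnj (sgn (z j) ^ (m k - 1)) * reduced_kernel c k u (v k $ i) (v k $ j)" for i j
          by (rule eigenvalue_kernel_eq_reduced[where u = u and v = "v k $ i" and w = "v k $ j"])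
            (use elim u mN in \<open>auto simp: z_def\<close>)
        then show ?thesis by (simp only:)
      qed
      also have "\<dots> = Determinants.det (\<chi> i j. reduced_kernel c k u (v k $ i) (v k $ j))"
        by (rule det_unimodular_scale) (use z0 in \<open>simp add: norm_power norm_sgn\<close>)
      finally show ?case
        by (simp add: Let_def z_def)
    qed
  qed
  show ?thesis
    using Lim_transform_eventually[OF 1 3] unfolding 2 .
qed

end

section \<open>Compactness, growth of the matrix size, and conclusion\<close>

lemma compact_vec_all:
  fixes S :: "complex set"
  assumes "compact S"
  shows "compact {v :: complex ^ 'n. \<forall>i. v $ i \<in> S}"
  unfolding compact_eq_bounded_closed
proof
  obtain B where B: "\<And>x. x \<in> S \<Longrightarrow> norm x \<le> B"
    using compact_imp_bounded[OF assms] unfolding bounded_iff by blast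
  have "norm v \<le> (\<Sum>i\<in>(UNIV :: 'n set). B)" if "\<forall>i. v $ i \<in> S" for v :: "complex ^ 'n"
  proof -
    have "norm v \<le> (\<Sum>i\<in>UNIV. norm (v $ i))"
      unfolding norm_vec_def by (rule L2_set_le_sum) simp
    also have "\<dots> \<le> (\<Sum>i\<in>(UNIV :: 'n set). B)"
      by (rule sum_mono) (use B that in blast)
    finally show ?thesis .
  qed
  then show "bounded {v :: complex ^ 'n. \<forall>i. v $ i \<in> S}"
    unfolding bounded_iff by blast
  have "closed {v :: complex ^ 'n. v $ i \<in> S}" for i
    using closed_vimage[OF compact_imp_closed[OF assms], of "\<lambda>v :: complex ^ 'n. v $ i"]
    by (simp add: vimage_def continuous_intros)
  then show "closed {v :: complex ^ 'n. \<forall>i. v $ i \<in> S}"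
    by (rule closed_Collect_all)
qed

text \<open>Eventually \<open>M \<le> g * N\<close>, so \<open>M + N \<le> (g + 1) * N\<close>, and
  \<open>N\<close> has to grow with the sum.\<close>

lemma size_at_top_of_ratio:
  fixes M N :: "nat \<Rightarrow> nat"
  assumes N: "\<And>k. N k > 0" and sum: "filterlim (\<lambda>k. M k + N k) at_top sequentially"
    and ratio: "(\<lambda>k. real (M k) / real (N k)) \<longlonglongrightarrow> \<gamma>"
  shows "filterlim N at_top sequentially"
  unfolding filterlim_at_top
proof
  fix Z
  define g where "g = nat \<lceil>\<bar>\<gamma>\<bar> + 1\<rceil>"
  have "\<forall>\<^sub>F k in sequentially. real (M k) / real (N k) < \<bar>\<gamma>\<bar> + 1"
    using ratio by (rule order_tendstoD) simp
  moreover have "\<forall>\<^sub>F k in sequentially. (g + 1) * Z \<le> M k + N k"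
    using sum unfolding filterlim_at_top by blast
  ultimately show "\<forall>\<^sub>F k in sequentially. Z \<le> N k"
  proof eventually_elim
    case (elim k)
    have "real (M k) / real (N k) \<le> real g"
      using elim(1) by (simp add: g_def) linarith
    then have "real (M k) \<le> real (g * N k)"
      using N[of k] by (simp add: divide_le_eq)
    then have "M k \<le> g * N k" by (simp only: of_nat_le_iff)
    with elim(2) have "(g + 1) * Z \<le> (g + 1) * N k" by simp
    then show ?case by (simp only: mult_le_cancel1)
  qed
qed

theorem theorem3p2:
  fixes M N L :: "nat \<Rightarrow> nat"
    and \<gamma> \<tau> q \<theta> c :: real
    and u :: "nat \<Rightarrow> complex"
    and P :: "nat \<Rightarrow> 'w measure"
    and X :: "nat \<Rightarrow> nat \<Rightarrow> 'w \<Rightarrow> complex Matrix.mat"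
    and R :: "nat \<Rightarrow> complex ^ 'n \<Rightarrow> real"
    and S :: "complex set"
  assumes pos: "\<And>k. M k > 0" "\<And>k. N k > 0" "\<And>k. L k > 0"
    and "filterlim (\<lambda>k. M k + N k) at_top sequentially"
    and "\<gamma> > 0" and "(\<lambda>k. real (M k) / real (N k)) \<longlonglongrightarrow> \<gamma>"
    and "\<tau> > 0" and "(\<lambda>k. real (L k) / real (N k)) \<longlonglongrightarrow> \<tau>"
    and "0 \<le> q" and "q < 1"
    and "- pi < \<theta>" and "\<theta> \<le> pi"
    and "\<And>k. u k = of_real (cmod (u k)) * exp (\<i> * of_real \<theta>)"
    and "\<And>k. (cmod (u k))\<^sup>2 = base_modulus_sq q (N k) (L k)"
    and "c > 0"
    and model: "\<And>k. iid_truncated_unitaries (P k) (M k) (N k) (L k) (X k)"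
    and corr: "\<And>k. correlation_function (P k)
      (\<lambda>\<omega>. eigenvalue_list (matrix_product (N k) (\<lambda>i. X k i \<omega>) (M k))) (R k)"
    and determinantal: "\<And>k z. complex_of_real (R k z) =
      Determinants.det (\<chi> i j. eigenvalue_kernel c (M k) (N k) (L k) (z $ i) (z $ j))"
    and "compact S"
  shows "uniform_limit {v :: complex ^ 'n. \<forall>i. v $ i \<in> S}
    (\<lambda>k v. let z = (\<chi> i. scaled_point \<gamma> \<tau> q (M k) (N k) (u k) (v $ i))
           in complex_of_real ((cmod (\<Prod>i\<in>UNIV. z $ i))\<^sup>2 * R k z))
    (\<lambda>v. if q = 0
         then Determinants.det (\<chi> i j. K_edge_crit (\<gamma> * \<tau> / (1 + \<tau>)) (v $ i) (v $ j))
         else Determinants.det (\<chi> i j.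
           K_bulk_crit (\<gamma> * \<tau> / ((1 - q) * (1 - q + \<tau>))) (v $ i) (v $ j)))
    sequentially"
proof -
  define m where "m k = N k - nat \<lfloor>q * real (N k)\<rfloor>" for k
  have fl: "0 \<le> \<lfloor>q * real (N k)\<rfloor>" "\<lfloor>q * real (N k)\<rfloor> < int (N k)" for k
    using \<open>0 \<le> q\<close> \<open>q < 1\<close> pos(2)[of k] by (auto simp: floor_less_iff)
  then have m_pos: "m k > 0" for k
    unfolding m_def by (metis nat_less_iff zero_less_diff)
  have m_real: "real (m k) = real (N k) - of_int \<lfloor>q * real (N k)\<rfloor>" for k
    using fl[of k] by (simp add: m_def of_nat_diff nat_le_iff)
  have N_lim: "filterlim N at_top sequentially"
    by (rule size_at_top_of_ratio[OF pos(2)]) fact+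
  then have real_N: "filterlim (\<lambda>k. real (N k)) at_top sequentially"
    using filterlim_real_sequentially filterlim_compose by blast
  have m_lim: "(\<lambda>k. real (m k) / real (N k)) \<longlonglongrightarrow> 1 - q"
  proof -
    have "(\<lambda>k. real (m k) / real (N k) - (1 - q)) \<longlonglongrightarrow> 0"
    proof (rule Lim_null_comparison[OF always_eventually tendsto_inverse_0_at_top[OF real_N]], rule allI)
      fix k
      have "real (m k) / real (N k) - (1 - q) = (q * real (N k) - of_int \<lfloor>q * real (N k)\<rfloor>) / real (N k)"
        using pos(2)[of k] by (simp add: m_real field_simps)
      also have "\<bar>\<dots>\<bar> \<le> 1 / real (N k)"
      proof -
        have "\<bar>q * real (N k) - of_int \<lfloor>q * real (N k)\<rfloor>\<bar> \<le> 1" by linarith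
        then show ?thesis
          unfolding abs_divide abs_of_nat by (rule divide_right_mono) simp
      qed
      finally show "norm (real (m k) / real (N k) - (1 - q)) \<le> inverse (real (N k))"
        by (simp add: inverse_eq_divide)
    qed
    then show ?thesis by (simp only: LIM_zero_iff)
  qed
  \<comment> \<open>With \<open>p = 1 - q\<close> the constant \<open>\<beta>\<close> of the locale
    is the parameter of the critical kernel, and the shift in \<open>scaled_point\<close> is a
    quarter of it.\<close>
  interpret critical_regime M N L m \<gamma> \<tau> "1 - q"
    by unfold_locales (use assms m_pos m_lim N_lim in auto)
  have u: "(cmod (u k))\<^sup>2 = real (m k) / (real (m k) + real (L k))" for k
  proof -
    have "1 - 1 / real (N k) * of_int \<lfloor>q * real (N k)\<rfloor> = real (m k) / real (N k)"
      using pos(2)[of k] by (simp add: m_real field_simps)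
    moreover have "real (m k) / real (N k) / (real (m k) / real (N k) + real (L k) / real (N k)) = real (m k) / (real (m k) + real (L k))"
      using pos(2)[of k] by (simp add: add_divide_distrib[symmetric])
    ultimately show ?thesis
      unfolding assms(14) base_modulus_sq_def Let_def by (simp only:)
  qed
  have mN: "m k \<le> N k" for k by (simp add: m_def)
  have scaled: "scaled_point \<gamma> \<tau> q (M k) (N k) (u k) x = u k ^ M k * local_factor k x" for k x
  proof -
    have "\<gamma> * \<tau> / (4 * (1 - q) * (1 - q + \<tau>)) = \<beta> / 4"
      by (simp add: \<beta>_def)
    then show ?thesis
      by (simp only: scaled_point_def local_factor_def)
  qed
  show ?thesis
  proof (rule uniform_limit_compact_sequentially[OF compact_vec_all[OF \<open>compact S\<close>]])
    fix v :: "nat \<Rightarrow> complex ^ 'n" and a assume v: "v \<longlonglongrightarrow> a"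
    show "(\<lambda>k. let z = (\<chi> i. scaled_point \<gamma> \<tau> q (M k) (N k) (u k) (v k $ i))
           in complex_of_real ((cmod (\<Prod>i\<in>UNIV. z $ i))\<^sup>2 * R k z)) \<longlonglongrightarrow>
      (if q = 0
         then Determinants.det (\<chi> i j. K_edge_crit (\<gamma> * \<tau> / (1 + \<tau>)) (a $ i) (a $ j))
         else Determinants.det (\<chi> i j.
           K_bulk_crit (\<gamma> * \<tau> / ((1 - q) * (1 - q + \<tau>))) (a $ i) (a $ j)))"
    proof (cases "q = 0")
      case True
      then have NM: "m k = N k" for k by (simp add: m_def)
      have edge: "\<gamma> * \<tau> / (1 + \<tau>) = \<beta>"
        unfolding \<beta>_def by (simp add: True)
      show ?thesis
        unfolding scaled if_P[OF True] edge
      proof (rule correlation_limit[where a = a and Kc = "K_edge_crit \<beta>", OF u mN determinantal _ v])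
        show "\<exists>e. (\<lambda>k. reduced_kernel c k u (x k) (y k)) \<longlonglongrightarrow> e \<and> K_edge_crit \<beta> a b = gauge a * cnj (gauge b) * e"
          if "x \<longlonglongrightarrow> a" "y \<longlonglongrightarrow> b" for x y a b
          by (rule edge_limit[OF NM \<open>c > 0\<close> u that])
      qed
    next
      case False
      with \<open>0 \<le> q\<close> have "q > 0" by simp
      \<comment> \<open>\<open>N - m\<close> is \<open>\<lfloor>q N\<rfloor>\<close>, which grows
        like \<open>q N\<close>; hence the sum above the peak becomes infinite in the limit.\<close>
      have NM: "filterlim (\<lambda>k. N k - m k) at_top sequentially"
      proof (rule filterlim_proportional)
        have "(\<lambda>k. 1 - real (m k) / real (N k)) \<longlonglongrightarrow> 1 - (1 - q)"
          by (intro tendsto_intros m_lim)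
        moreover have "1 - real (m k) / real (N k) = real (N k - m k) / real (N k)" for k
          using pos(2)[of k] mN[of k] by (simp add: of_nat_diff diff_divide_distrib)
        ultimately show "(\<lambda>k. real (N k - m k) / real (N k)) \<longlonglongrightarrow> q" by simp
      qed fact
      show ?thesis
        unfolding scaled if_not_P[OF False] \<beta>_def[symmetric]
      proof (rule correlation_limit[where a = a and Kc = "K_bulk_crit \<beta>", OF u mN determinantal _ v])
        show "\<exists>e. (\<lambda>k. reduced_kernel c k u (x k) (y k)) \<longlonglongrightarrow> e \<and> K_bulk_crit \<beta> a b = gauge a * cnj (gauge b) * e"
          if "x \<longlonglongrightarrow> a" "y \<longlonglongrightarrow> b" for x y a b
          by (rule bulk_limit[OF NM \<open>c > 0\<close> u that])
      qed
    qed
  qed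
qed

end
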